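(* Let $\varphi,\psi$ satisfy the standing hypotheses given in the context. For every $\eta>0$ there exists $R_\eta>0$ such that, for every optimal trajectory with final point $X_1=(x_1,y_1,\theta_1,0)$ satisfying $|(x_1,y_1)|\ge R_\eta$ and every associated adjoint vector $p=(p_1,p_2,p_3,p_4)$, writing $(x_1,y_1)=|(x_1,y_1)|(\cos\alpha,\sin\alpha)$ and $(p_1,p_2)=\rho(\cos\phi,\sin\phi)$ with $\rho\ge 0$ and $\alpha,\phi\in[0,2\pi)$, one has $$|\phi-\alpha|\le\eta\qquad\text{and}\qquad|\rho-1|\le\eta .$$
   Context: Standing hypotheses on the cost: (1) $\varphi$ and $\psi$ are nonnegative, even, $C^2$ functions on $\mathbb{R}$, nondecreasing on $[0,\infty)$, with $\varphi(0)=\psi(0)=0$; (2) $\psi$ is strictly convex and $\psi''(0)>0$; (3) there exist $p>1$ and constants $C,R>0$ such that $\psi(r)\ge C|r|^p$ for all $|r|\ge R$. Control system: the state is $X=(x,y,\theta,\kappa)\in\mathbb{R}^2\times S^1\times\mathbb{R}$; a control is a measurable function $u:[0,T]\to\mathbb{R}$ with finite $L^p$ norm ($T>0$ depends on $u$), and its trajectory solves $\dot x=\cos\theta,\ \dot y=\sin\theta,\ \dot\theta=\kappa,\ \dot\kappa=u$. Optimal trajectory: fix $X_0=(0,0,\pi/2,0)$. An optimal trajectory is a trajectory on $[0,T]$ with $X(0)=X_0$ and $X(T)=X_1$, for some $X_1=(x_1,y_1,\theta_1,0)$, which minimizes $\int_0^T[1+\varphi(\kappa)+\psi(u)]\,dt$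 among all trajectories from $X_0$ to $X_1$ with free final time $T$. Adjoint vector: an adjoint vector associated with an optimal trajectory is an absolutely continuous $p=(p_1,p_2,p_3,p_4):[0,T]\to\mathbb{R}^4$ with $\dot p_1=\dot p_2=0$, $\dot p_3=p_1\sin\theta-p_2\cos\theta$, $\dot p_4=-p_3+\varphi'(\kappa)$, $u(t)=(\psi')^{-1}(p_4(t))$ for a.e. $t$, and $p_1\cos\theta+p_2\sin\theta+p_3\kappa+p_4u-(1+\varphi(\kappa)+\psi(u))=0$ along the trajectory. (By the Pontryagin maximum principle, every optimal trajectory admits such a $p$; abnormal extremals do not occur.) Differences of angles are taken modulo $2\pi$ with values in $[-\pi,\pi]$. *)

theory Defs
  imports "HOL-Analysis.Analysis" "HOL-Library.Real_Mod"
begin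

definition C2 :: "(real \<Rightarrow> real) \<Rightarrow> bool" where
  "C2 f \<longleftrightarrow> (\<forall>r. f field_differentiable at r) \<and> (\<forall>r. deriv f field_differentiable at r) \<and>
    continuous_on UNIV (deriv (deriv f))"

definition even_fun :: "(real \<Rightarrow> real) \<Rightarrow> bool" where
  "even_fun f \<longleftrightarrow> (\<forall>r. f (- r) = f r)"

definition strictly_convex :: "(real \<Rightarrow> real) \<Rightarrow> bool" where
  "strictly_convex f \<longleftrightarrow> (\<forall>a b s. a \<noteq> b \<and> 0 < s \<and> s < 1 \<longrightarrow>
    f ((1 - s) * a + s * b) < (1 - s) * f a + s * f b)"

text \<open>The usual epsilon-delta notion for functions on the compact interval \<open>[a, b]\<close>; the library
  constant \<^const>\<open>absolutely_continuous\<close> is about measures. The pairs in \<open>D\<close> are the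
  endpoints of finitely many nonoverlapping subintervals.\<close>

definition abs_cont_on :: "real \<Rightarrow> real \<Rightarrow> (real \<Rightarrow> real) \<Rightarrow> bool" where
  "abs_cont_on a b f \<longleftrightarrow> (\<forall>\<epsilon>>0. \<exists>\<delta>>0. \<forall>D.
    finite D \<and> (\<forall>(s, t)\<in>D. a \<le> s \<and> s \<le> t \<and> t \<le> b) \<and>
    disjoint_family_on (\<lambda>(s, t). {s<..<t}) D \<and> (\<Sum>(s, t)\<in>D. t - s) < \<delta> \<longrightarrow>
    (\<Sum>(s, t)\<in>D. \<bar>f t - f s\<bar>) < \<epsilon>)"

text \<open>Solutions of \<open>f' = g\<close> on \<open>[0, T]\<close> in the sense of Caratheodory.\<close>

definition solves_ae :: "real \<Rightarrow> (real \<Rightarrow> real) \<Rightarrow> (real \<Rightarrow> real) \<Rightarrow> bool" where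
  "solves_ae T f g \<longleftrightarrow> abs_cont_on 0 T f \<and>
    (AE t in lebesgue_on {0..T}. (f has_real_derivative g t) (at t within {0..T}))"

definition control :: "real \<Rightarrow> real \<Rightarrow> (real \<Rightarrow> real) \<Rightarrow> bool" where
  "control q T u \<longleftrightarrow> 0 < T \<and> u \<in> borel_measurable (lebesgue_on {0..T}) \<and>
    integrable (lebesgue_on {0..T}) (\<lambda>t. \<bar>u t\<bar> powr q)"

text \<open>The \<open>S\<^sup>1\<close>-component of the state is represented by a continuous real-valued lift \<open>\<theta>\<close>.
  Points of \<open>S\<^sup>1\<close> are therefore compared modulo \<open>2\<pi>\<close>; in particular the winding
  number of a trajectory is not prescribed by its endpoints.\<close>

definition trajectory ::
  "real \<Rightarrow> real \<Rightarrow> (real \<Rightarrow> real) \<Rightarrow> (real \<Rightarrow> real) \<Rightarrow> (real \<Rightarrow> real) \<Rightarrow> (real \<Rightarrow> real) \<Rightarrow> (real \<Rightarrow> real) \<Rightarrow> bool"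
where
  "trajectory q T u x y \<theta> \<kappa> \<longleftrightarrow> control q T u \<and>
    solves_ae T x (\<lambda>t. cos (\<theta> t)) \<and> solves_ae T y (\<lambda>t. sin (\<theta> t)) \<and>
    solves_ae T \<theta> \<kappa> \<and> solves_ae T \<kappa> u"

definition same_state :: "real \<times> real \<times> real \<times> real \<Rightarrow> real \<times> real \<times> real \<times> real \<Rightarrow> bool" where
  "same_state = (\<lambda>(x, y, \<theta>, \<kappa>) (x', y', \<theta>', \<kappa>').
    x = x' \<and> y = y' \<and> [\<theta> = \<theta>'] (rmod (2 * pi)) \<and> \<kappa> = \<kappa>')"

definition steers ::
  "real \<Rightarrow> real \<times> real \<times> real \<times> real \<Rightarrow> real \<times> real \<times> real \<times> real \<Rightarrow>
   real \<Rightarrow> (real \<Rightarrow> real) \<Rightarrow> (real \<Rightarrow> real) \<Rightarrow> (real \<Rightarrow> real) \<Rightarrow> (real \<Rightarrow> real) \<Rightarrow> (real \<Rightarrow> real) \<Rightarrow> bool"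
where
  "steers q X\<^sub>0 X\<^sub>1 T u x y \<theta> \<kappa> \<longleftrightarrow> trajectory q T u x y \<theta> \<kappa> \<and>
    same_state (x 0, y 0, \<theta> 0, \<kappa> 0) X\<^sub>0 \<and> same_state (x T, y T, \<theta> T, \<kappa> T) X\<^sub>1"

text \<open>The cost is extended-real valued: \<open>\<psi>\<close> may grow faster than the power \<open>q\<close>, so that
  \<open>u\<close> in \<open>L\<^sup>q\<close> does not imply that the cost is finite.\<close>

definition cost ::
  "(real \<Rightarrow> real) \<Rightarrow> (real \<Rightarrow> real) \<Rightarrow> real \<Rightarrow> (real \<Rightarrow> real) \<Rightarrow> (real \<Rightarrow> real) \<Rightarrow> ennreal"
where
  "cost \<phi> \<psi> T u \<kappa> = (\<integral>\<^sup>+ t. ennreal (1 + \<phi> (\<kappa> t) + \<psi> (u t)) \<partial>lebesgue_on {0..T})"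

definition start_state :: "real \<times> real \<times> real \<times> real" where
  "start_state = (0, 0, pi / 2, 0)"

definition optimal_trajectory ::
  "(real \<Rightarrow> real) \<Rightarrow> (real \<Rightarrow> real) \<Rightarrow> real \<Rightarrow> real \<times> real \<times> real \<times> real \<Rightarrow>
   real \<Rightarrow> (real \<Rightarrow> real) \<Rightarrow> (real \<Rightarrow> real) \<Rightarrow> (real \<Rightarrow> real) \<Rightarrow> (real \<Rightarrow> real) \<Rightarrow> (real \<Rightarrow> real) \<Rightarrow> bool"
where
  "optimal_trajectory \<phi> \<psi> q X\<^sub>1 T u x y \<theta> \<kappa> \<longleftrightarrow>
    (\<exists>x\<^sub>1 y\<^sub>1 \<theta>\<^sub>1. X\<^sub>1 = (x\<^sub>1, y\<^sub>1, \<theta>\<^sub>1, 0)) \<and>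
    steers q start_state X\<^sub>1 T u x y \<theta> \<kappa> \<and>
    (\<forall>T' u' x' y' \<theta>' \<kappa>'. steers q start_state X\<^sub>1 T' u' x' y' \<theta>' \<kappa>' \<longrightarrow>
      cost \<phi> \<psi> T u \<kappa> \<le> cost \<phi> \<psi> T' u' \<kappa>')"

text \<open>Controls are only determined up to null sets, hence the Hamiltonian identity is required
  almost everywhere.\<close>

definition adjoint_vector ::
  "(real \<Rightarrow> real) \<Rightarrow> (real \<Rightarrow> real) \<Rightarrow> real \<Rightarrow> (real \<Rightarrow> real) \<Rightarrow> (real \<Rightarrow> real) \<Rightarrow> (real \<Rightarrow> real) \<Rightarrow>
   (real \<Rightarrow> real) \<Rightarrow> (real \<Rightarrow> real) \<Rightarrow> (real \<Rightarrow> real) \<Rightarrow> (real \<Rightarrow> real) \<Rightarrow> bool"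
where
  "adjoint_vector \<phi> \<psi> T u \<theta> \<kappa> p\<^sub>1 p\<^sub>2 p\<^sub>3 p\<^sub>4 \<longleftrightarrow>
    solves_ae T p\<^sub>1 (\<lambda>t. 0) \<and> solves_ae T p\<^sub>2 (\<lambda>t. 0) \<and>
    solves_ae T p\<^sub>3 (\<lambda>t. p\<^sub>1 t * sin (\<theta> t) - p\<^sub>2 t * cos (\<theta> t)) \<and>
    solves_ae T p\<^sub>4 (\<lambda>t. - p\<^sub>3 t + deriv \<phi> (\<kappa> t)) \<and>
    (AE t in lebesgue_on {0..T}. u t = inv (deriv \<psi>) (p\<^sub>4 t)) \<and>
    (AE t in lebesgue_on {0..T}.
      p\<^sub>1 t * cos (\<theta> t) + p\<^sub>2 t * sin (\<theta> t) + p\<^sub>3 t * \<kappa> t + p\<^sub>4 t * u t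
        - (1 + \<phi> (\<kappa> t) + \<psi> (u t)) = 0)"

text \<open>\<^const>\<open>Arg\<close> takes its values in \<open>(-\<pi>, \<pi>]\<close>, so this is the representative of
  \<open>a - b\<close> modulo \<open>2\<pi>\<close> in that interval.\<close>

definition angle_diff :: "real \<Rightarrow> real \<Rightarrow> real" where
  "angle_diff a b = Arg (cis (a - b))"

end

theory Submission
  imports Defs
begin

text \<open>Turning to a suitable heading, going straight and turning again costs at most
  \<open>r + C\<close>, where \<open>r = |(x\<^sub>1, y\<^sub>1)|\<close> and \<open>C\<close> does not depend on the final point. Since
  \<open>r = \<integral> cos (\<theta> - \<alpha>)\<close>, an optimal trajectory satisfies
  \<open>\<integral> (1 - cos (\<theta> - \<alpha>) + \<phi> (\<kappa>) + \<psi> (u)) \<le> C\<close> on an interval of length at least \<open>r\<close>, so for large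
  \<open>r\<close> this integral is tiny on some unit interval. There \<open>\<kappa>\<close> and \<open>\<theta> - \<alpha>\<close> are uniformly small,
  and \<open>u\<close>, hence \<open>p\<^sub>4 = \<psi>' (u)\<close>, is small at well-spaced points. The mean value theorem
  applied to \<open>p\<^sub>4\<close> and then to \<open>p\<^sub>3\<close> shows that the component of \<open>(p\<^sub>1, p\<^sub>2)\<close> orthogonal to
  \<open>(cos \<alpha>, sin \<alpha>)\<close> is small, and the vanishing of the Hamiltonian that the parallel component
  is close to 1.\<close>

text \<open>The excess does not control the curvature directly, since \<phi> may vanish identically.
  It does control the integral of the absolute value of \<open>u\<close>, by strict convexity of
  \<psi>. Hence \<kappa> is almost constant on the chosen unit interval. An almost constant
  curvature that is not small would turn the heading away from \<alpha>, but the heading is close to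
  \<alpha> near both ends of the interval.

  No a priori bound on the adjoint vector is available. Smallness of \<open>p\<^sub>4\<close> at two
  times yields one time at which \<open>p\<^sub>3\<close> is small, and two such times are needed to
  bound the derivative of \<open>p\<^sub>3\<close>. This asks for four sample times; they are taken
  in four windows of length 1/7, separated by gaps of length 1/7, which fill a unit interval. The
  component of the adjoint vector along \<alpha> is bounded only at the very end, so every earlier
  estimate carries an error proportional to it, which is finally absorbed.\<close>

section \<open>Absolutely continuous functions\<close>

text \<open>The fundamental theorem of calculus by a gauge. Off \<open>N\<close> differentiability
  supplies the gauge, and these tags contribute at most \<open>e' * (b - a)\<close>. Intervals
  tagged in \<open>N\<close> are confined to an open set of measure below the \<delta> of absolute
  continuity, which bounds the sum of the increments of \<open>f\<close> over them.\<close>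

lemma abs_cont_on_has_integral:
  fixes f g :: "real \<Rightarrow> real"
  assumes ac: "abs_cont_on a b f" and ab: "a \<le> b" and N: "negligible N"
    and der: "\<And>t. t \<in> {a..b} - N \<Longrightarrow> (f has_real_derivative g t) (at t within {a..b})"
  shows "(g has_integral f b - f a) {a..b}"
proof -
  let ?g = "\<lambda>t. if t \<in> N then 0 else g t"
  have "(?g has_integral f b - f a) {a..b}"
    unfolding has_integral_real
  proof (intro allI impI)
    fix e :: real assume "e > 0"
    \<comment> \<open>The summand 1 keeps \<open>e'\<close> positive when
      \<open>a = b\<close>.\<close>
    define e' where "e' = e / (2 * (b - a + 1))"
    have "e' > 0" and e': "e' * (b - a) \<le> e / 2"
      using \<open>e > 0\<close> ab by (auto simp: e'_def field_simps)
    obtain \<delta> where "\<delta> > 0" and \<delta>: "\<And>D. \<lbrakk>finite D; \<And>s t. (s, t) \<in> D \<Longrightarrow> a \<le> s \<and> s \<le> t \<and> t \<le> b;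
        disjoint_family_on (\<lambda>(s, t). {s<..<t}) D; (\<Sum>(s, t)\<in>D. t - s) < \<delta>\<rbrakk> \<Longrightarrow>
        (\<Sum>(s, t)\<in>D. \<bar>f t - f s\<bar>) < e / 2"
    proof -
      have "0 < e / 2" using \<open>e > 0\<close> by simp
      then obtain \<delta> where "\<delta> > 0" and *: "\<forall>D. finite D \<and> (\<forall>(s, t)\<in>D. a \<le> s \<and> s \<le> t \<and> t \<le> b) \<and>
          disjoint_family_on (\<lambda>(s, t). {s<..<t}) D \<and> (\<Sum>(s, t)\<in>D. t - s) < \<delta> \<longrightarrow>
          (\<Sum>(s, t)\<in>D. \<bar>f t - f s\<bar>) < e / 2"
        using ac unfolding abs_cont_on_def by meson
      show ?thesis
        by (rule that[OF \<open>\<delta> > 0\<close>]) (use * in blast)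
    qed
    obtain V where "open V" "N \<subseteq> V" and V: "V \<in> lmeasurable" "measure lebesgue V < \<delta>"
    proof -
      obtain S where S: "open S" "N \<subseteq> S" "S - N \<in> lmeasurable" "emeasure lebesgue (S - N) < ennreal \<delta>"
        using sets_lebesgue_outer_open[of N \<delta>] N \<open>\<delta> > 0\<close> negligible_imp_sets by blast
      have "S = N \<union> (S - N)" using S(2) by auto
      then have m: "S \<in> lmeasurable" "measure lebesgue S = measure lebesgue (S - N)"
        using N S(3) negligible_imp_measurable[OF N]
        by (metis fmeasurable.Un, metis measure_Un_null_set inf_sup_aci(5) fmeasurableD negligible_iff_null_sets)
      have "measure lebesgue (S - N) < \<delta>"
        using S(3,4) \<open>\<delta> > 0\<close> by (simp add: emeasure_eq_measure2 ennreal_less_iff)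
      then show ?thesis using that S m by auto
    qed
    have "\<exists>d>0. t \<in> {a..b} - N \<longrightarrow> (\<forall>y\<in>{a..b}. \<bar>y - t\<bar> < d \<longrightarrow> \<bar>f y - f t - (y - t) * g t\<bar> \<le> e' * \<bar>y - t\<bar>)" for t
    proof (cases "t \<in> {a..b} - N")
      case True
      from der[OF this] \<open>e' > 0\<close> show ?thesis
        unfolding has_field_derivative_def has_derivative_within_alt by (force simp: mult.commute)
    qed (use zero_less_one in blast)
    then obtain d where d0: "\<And>t. d t > 0" and d: "\<And>t y. \<lbrakk>t \<in> {a..b} - N; y \<in> {a..b}; \<bar>y - t\<bar> < d t\<rbrakk> \<Longrightarrow>
        \<bar>f y - f t - (y - t) * g t\<bar> \<le> e' * \<bar>y - t\<bar>"
      by metis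
    define \<gamma> where "\<gamma> t = (if t \<in> N then V else ball t (d t))" for t
    have gauge: "gauge \<gamma>"
      using d0 \<open>open V\<close> \<open>N \<subseteq> V\<close> by (auto simp: gauge_def \<gamma>_def)
    have main: "norm ((\<Sum>(x,K)\<in>p. measure lborel K *\<^sub>R ?g x) - (f b - f a)) < e"
      if p: "p tagged_division_of {a..b}" "\<gamma> fine p" for p
    proof -
      have fin: "finite p" using p(1) by (rule tagged_division_of_finite)
      have sums: "b - a = (\<Sum>(x,K)\<in>p. Sup K - Inf K)" "f b - f a = (\<Sum>(x,K)\<in>p. f(Sup K) - f(Inf K))"
        using additive_tagged_division_1[OF ab p(1), where f = "\<lambda>x. x"]
          additive_tagged_division_1[OF ab p(1), where f = f] by auto
      have box: "\<exists>u v. K = {u..v} \<and> u \<le> x \<and> x \<le> v \<and> a \<le> u \<and> v \<le> b" if xK: "(x, K) \<in> p" for x K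
      proof -
        obtain u v where "K = cbox u v" using tagged_division_ofD(4)[OF p(1) xK] by blast
        moreover have "x \<in> K" "K \<subseteq> {a..b}" using tagged_division_ofD(2,3)[OF p(1) xK] by auto
        ultimately show ?thesis by auto
      qed
      \<comment> \<open>Degenerate intervals are put into \<open>W\<close>: their interiors are
        empty, so disjointness of interiors would not distinguish them in the proof of
        \<open>inj\<close>.\<close>
      define P where "P = {(x, K) \<in> p. x \<in> N \<and> Inf K \<noteq> Sup K}"
      define W where "W = {(x, K) \<in> p. x \<in> N \<and> Inf K = Sup K}"
      define Q where "Q = {(x, K) \<in> p. x \<notin> N}"
      have PQ: "p = P \<union> (W \<union> Q)" "P \<inter> (W \<union> Q) = {}" "W \<inter> Q = {}" "finite P" "finite Q" "finite W"
        using fin by (auto simp: P_def Q_def W_def intro: finite_subset[of _ p])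
      define h where "h = (\<lambda>(x,K). measure lborel K *\<^sub>R ?g x - (f (Sup K) - f (Inf K)))"
      have "\<bar>sum h Q\<bar> \<le> (\<Sum>(x,K)\<in>Q. e' * (Sup K - Inf K))"
      proof (rule order_trans[OF sum_abs], rule sum_mono, clarify)
        fix x K assume "(x, K) \<in> Q"
        then have xK: "(x, K) \<in> p" "x \<notin> N" by (auto simp: Q_def)
        obtain u v where K: "K = {u..v}" "u \<le> x" "x \<le> v" "a \<le> u" "v \<le> b" using box[OF xK(1)] by auto
        have "K \<subseteq> ball x (d x)" using fineD[OF p(2) xK(1)] xK(2) by (simp add: \<gamma>_def)
        moreover have "u \<in> K" "v \<in> K" using K by auto
        ultimately have "\<bar>u - x\<bar> < d x" "\<bar>v - x\<bar> < d x"
          by (auto simp: dist_real_def subset_iff abs_minus_commute)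
        with d[of x u] d[of x v] K xK
        have "\<bar>f u - f x - (u - x) * g x\<bar> \<le> e' * (x - u)" "\<bar>f v - f x - (v - x) * g x\<bar> \<le> e' * (v - x)"
          by auto
        then have "\<bar>(v - u) * g x - (f v - f u)\<bar> \<le> e' * (v - u)"
          by (simp add: algebra_simps)
        then show "\<bar>h (x, K)\<bar> \<le> e' * (Sup K - Inf K)"
          using K xK by (simp add: h_def)
      qed
      also have "\<dots> = e' * (\<Sum>(x,K)\<in>Q. Sup K - Inf K)"
        by (simp add: sum_distrib_left split_def)
      also have "\<dots> \<le> e' * (\<Sum>(x,K)\<in>p. Sup K - Inf K)"
      proof (intro mult_left_mono sum_mono2)
        fix z assume "z \<in> p - Q"
        then show "0 \<le> (case z of (x, K) \<Rightarrow> Sup K - Inf K)"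
          using box by (cases z) fastforce
      qed (use fin \<open>e' > 0\<close> in \<open>auto simp: Q_def\<close>)
      finally have hQ: "\<bar>sum h Q\<bar> \<le> e / 2"
        using e' sums(1) by simp
      have hW: "sum h W = 0"
      proof (rule sum.neutral, clarify)
        fix x K assume "(x, K) \<in> W"
        then show "h (x, K) = 0" by (auto simp: h_def W_def)
      qed
      let ?i = "\<lambda>(x::real, K::real set). (Inf K, Sup K)"
      have Pbox: "\<exists>u v. K = {u..v} \<and> u < v \<and> u \<le> x \<and> x \<le> v \<and> a \<le> u \<and> v \<le> b \<and> x \<in> N \<and> (x, K) \<in> p"
        if "(x, K) \<in> P" for x K
      proof -
        have "(x, K) \<in> p" "x \<in> N" "Inf K \<noteq> Sup K" using that by (auto simp: P_def)
        with box[OF this(1)] show ?thesis by force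
      qed
      have disj: "interior K \<inter> interior K' = {}" if "(x, K) \<in> P" "(x', K') \<in> P" "(x, K) \<noteq> (x', K')" for x K x' K'
        using that tagged_division_ofD(5)[OF p(1)] unfolding P_def by blast
      have inj: "inj_on ?i P" "inj_on snd P"
      proof -
        have "x = x' \<and> K = K'" if "(x, K) \<in> P" "(x', K') \<in> P" "Inf K = Inf K'" "Sup K = Sup K'" for x K x' K'
        proof (rule ccontr)
          assume "\<not> (x = x' \<and> K = K')"
          with disj[OF that(1,2)] have "interior K \<inter> interior K' = {}" by auto
          with Pbox[OF that(1)] Pbox[OF that(2)] that(3,4) show False
            by (auto simp: interior_atLeastAtMost_real)
        qed
        then show "inj_on ?i P" "inj_on snd P" by (auto simp: inj_on_def) 
      qed
      have "\<bar>sum h P\<bar> \<le> (\<Sum>(x,K)\<in>P. \<bar>f (Sup K) - f (Inf K)\<bar>)"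
        by (rule order_trans[OF sum_abs], rule sum_mono) (auto simp: h_def P_def)
      also have "\<dots> = (\<Sum>(s, t)\<in>?i ` P. \<bar>f t - f s\<bar>)"
        by (subst sum.reindex[OF inj(1)]) (simp add: split_def o_def)
      also have "\<dots> < e / 2"
      proof (rule \<delta>)
        show "finite (?i ` P)" using PQ by auto
        show "a \<le> s \<and> s \<le> t \<and> t \<le> b" if "(s, t) \<in> ?i ` P" for s t
          using that Pbox by fastforce
        show "disjoint_family_on (\<lambda>(s, t). {s<..<t}) (?i ` P)"
          unfolding disjoint_family_on_def
        proof (intro ballI impI)
          fix m n assume "m \<in> ?i ` P" "n \<in> ?i ` P" "m \<noteq> n"
          then obtain x K x' K' where A: "(x, K) \<in> P" "(x', K') \<in> P" "m = (Inf K, Sup K)" "n = (Inf K', Sup K')"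
            by auto
          then have "interior K \<inter> interior K' = {}" using disj[OF A(1,2)] \<open>m \<noteq> n\<close> by auto
          with Pbox[OF A(1)] Pbox[OF A(2)]
          show "(case m of (s, t) \<Rightarrow> {s<..<t}) \<inter> (case n of (s, t) \<Rightarrow> {s<..<t}) = {}"
            unfolding A by (auto simp: interior_atLeastAtMost_real)
        qed
        \<comment> \<open>The intervals do not overlap, so their total length is the measure of
          their union, which lies in \<open>V\<close>.\<close>
        have "P tagged_partial_division_of {a..b}"
          using p(1) tagged_partial_division_subset[of p _ P] unfolding tagged_division_of_def P_def by auto
        then have div: "(snd ` P) division_of \<Union>(snd ` P)"
          by (rule partial_division_of_tagged_division)
        have "(\<Sum>(s, t)\<in>?i ` P. t - s) = (\<Sum>(x,K)\<in>P. Sup K - Inf K)"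
          by (subst sum.reindex[OF inj(1)]) (simp add: split_def o_def)
        also have "\<dots> = (\<Sum>(x,K)\<in>P. measure lebesgue K)"
        proof (rule sum.cong, simp, clarify)
          fix x K assume "(x, K) \<in> P"
          from Pbox[OF this] show "Sup K - Inf K = measure lebesgue K" by auto
        qed
        also have "\<dots> = (\<Sum>K\<in>snd ` P. measure lebesgue K)"
          by (subst sum.reindex[OF inj(2)]) (simp add: split_def o_def)
        also have "\<dots> = measure lebesgue (\<Union>(snd ` P))"
          by (rule content_division[OF div])
        also have "\<dots> \<le> measure lebesgue V"
        proof (rule measure_mono_fmeasurable)
          show "\<Union>(snd ` P) \<subseteq> V"
          proof clarsimp
            fix t t0 K assume "(t0, K) \<in> P" "t \<in> K"
            then have "(t0, K) \<in> p" "t0 \<in> N" by (auto simp: P_def)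
            then have "K \<subseteq> V" using fineD[OF p(2), of t0 K] by (simp add: \<gamma>_def)
            then show "t \<in> V" using \<open>t \<in> K\<close> by auto
          qed
          show "\<Union>(snd ` P) \<in> sets lebesgue"
            using lmeasurable_division[OF div] by auto
        qed (rule V)
        finally show "(\<Sum>(s, t)\<in>?i ` P. t - s) < \<delta>" using V by simp
      qed
      finally have hP: "\<bar>sum h P\<bar> < e / 2" .
      have "sum h p = sum h P + (sum h W + sum h Q)"
        unfolding PQ(1) using PQ(2-6) by (simp add: sum.union_disjoint)
      then have "\<bar>sum h p\<bar> < e" using hP hQ hW by linarith
      moreover have "sum h p = (\<Sum>(x,K)\<in>p. measure lborel K *\<^sub>R ?g x) - (f b - f a)"
        by (simp add: h_def sums(2) sum_subtractf split_def)
      ultimately show ?thesis by simp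
    qed
    show "\<exists>\<gamma>. gauge \<gamma> \<and> (\<forall>\<D>. \<D> tagged_division_of {a..b} \<and> \<gamma> fine \<D> \<longrightarrow>
        norm ((\<Sum>(x,K)\<in>\<D>. measure lborel K *\<^sub>R ?g x) - (f b - f a)) < e)"
      by (intro exI[of _ \<gamma>] conjI allI impI gauge main) simp_all
  qed
  then show ?thesis
    by (rule has_integral_spike[OF N, rotated]) auto
qed

section \<open>Differential equations almost everywhere as integral equations\<close>

lemma AE_lebesgue_on_iff_negligible:
  assumes "S \<in> sets lebesgue"
  shows "(AE t in lebesgue_on S. P t) \<longleftrightarrow> (\<exists>N. negligible N \<and> (\<forall>t\<in>S - N. P t))"
proof -
  have "(AE t in lebesgue_on S. P t) \<longleftrightarrow> (AE t in lebesgue. t \<in> S \<longrightarrow> P t)"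
    using assms by (subst AE_restrict_space_iff) auto
  also have "\<dots> \<longleftrightarrow> (\<exists>N. negligible N \<and> (\<forall>t\<in>S - N. P t))"
  proof
    assume "AE t in lebesgue. t \<in> S \<longrightarrow> P t"
    then show "\<exists>N. negligible N \<and> (\<forall>t\<in>S - N. P t)"
      by (intro exI[of _ "{t. \<not> (t \<in> S \<longrightarrow> P t)}"])
        (auto simp: negligible_iff_null_sets completion.AE_iff_null_sets)
  next
    assume "\<exists>N. negligible N \<and> (\<forall>t\<in>S - N. P t)"
    then obtain N where "N \<in> null_sets lebesgue" "\<forall>t\<in>S - N. P t"
      by (auto simp: negligible_iff_null_sets)
    then show "AE t in lebesgue. t \<in> S \<longrightarrow> P t"
      by (intro AE_I'[of N]) auto
  qed
  finally show ?thesis .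
qed

text \<open>Turns an equation valid almost everywhere into an exact identity, also for \<kappa>,
  whose derivative \<open>u\<close> is merely measurable.\<close>

lemma solves_ae_has_integral:
  assumes f: "solves_ae T f g" and st: "0 \<le> s" "s \<le> t" "t \<le> T"
  shows "(g has_integral f t - f s) {s..t}"
proof -
  obtain N where N: "negligible N"
    and der: "\<And>r. r \<in> {0..T} - N \<Longrightarrow> (f has_real_derivative g r) (at r within {0..T})"
    using f unfolding solves_ae_def by (subst (asm) AE_lebesgue_on_iff_negligible) auto
  have "abs_cont_on s t f"
    unfolding abs_cont_on_def
  proof (intro allI impI)
    fix e :: real assume "e > 0"
    then obtain \<delta> where "\<delta> > 0" and \<delta>: "\<forall>D. finite D \<and> (\<forall>(s, t)\<in>D. 0 \<le> s \<and> s \<le> t \<and> t \<le> T) \<and>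
        disjoint_family_on (\<lambda>(s, t). {s<..<t}) D \<and> (\<Sum>(s, t)\<in>D. t - s) < \<delta> \<longrightarrow>
        (\<Sum>(s, t)\<in>D. \<bar>f t - f s\<bar>) < e"
      using f unfolding solves_ae_def abs_cont_on_def by meson
    show "\<exists>\<delta>>0. \<forall>D. finite D \<and> (\<forall>(s', t')\<in>D. s \<le> s' \<and> s' \<le> t' \<and> t' \<le> t) \<and>
        disjoint_family_on (\<lambda>(s, t). {s<..<t}) D \<and> (\<Sum>(s, t)\<in>D. t - s) < \<delta> \<longrightarrow>
        (\<Sum>(s, t)\<in>D. \<bar>f t - f s\<bar>) < e"
    proof (intro exI[of _ \<delta>] conjI allI impI \<open>\<delta> > 0\<close>, elim conjE)
      fix D assume D: "finite D" "\<forall>(s', t')\<in>D. s \<le> s' \<and> s' \<le> t' \<and> t' \<le> t"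
        "disjoint_family_on (\<lambda>(s, t). {s<..<t}) D" "(\<Sum>(s, t)\<in>D. t - s) < \<delta>"
      have "\<forall>(s', t')\<in>D. 0 \<le> s' \<and> s' \<le> t' \<and> t' \<le> T"
        using D(2) st by fastforce
      with \<delta> D show "(\<Sum>(s, t)\<in>D. \<bar>f t - f s\<bar>) < e" by blast
    qed
  qed
  then show ?thesis
    by (rule abs_cont_on_has_integral[OF _ st(2) N])
       (use st in \<open>auto intro!: has_field_derivative_subset[OF der]\<close>)
qed

lemma solves_ae_continuous_on:
  assumes "solves_ae T f g"
  shows "continuous_on {0..T} f"
proof (cases "0 \<le> T")
  case True
  have "g integrable_on {0..T}"
    using solves_ae_has_integral[OF assms order_refl True order_refl] by blast
  then have "continuous_on {0..T} (\<lambda>t. f 0 + integral {0..t} g)"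
    by (intro continuous_intros indefinite_integral_continuous_1)
  moreover have "f 0 + integral {0..t} g = f t" if "t \<in> {0..T}" for t
    using integral_unique[OF solves_ae_has_integral[OF assms, of 0 t]] that by simp
  ultimately show ?thesis by (rule continuous_on_eq)
qed simp

text \<open>A continuous right-hand side removes the exceptional null set; the mean value theorem
  will need the derivative at every point.\<close>

lemma solves_ae_has_derivative:
  assumes f: "solves_ae T f g" and g: "continuous_on {0..T} g" and t: "t \<in> {0..T}"
  shows "(f has_real_derivative g t) (at t within {0..T})"
proof -
  have "((\<lambda>t. f 0 + integral {0..t} g) has_real_derivative g t) (at t within {0..T})"
    using integral_has_real_derivative[OF g t] by (auto intro!: derivative_eq_intros)
  then show ?thesis
  proof (rule has_field_derivative_transform_within[OF _ zero_less_one t])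
    show "f 0 + integral {0..r} g = f r" if "r \<in> {0..T}" for r
      using integral_unique[OF solves_ae_has_integral[OF f, of 0 r]] that by simp
  qed
qed

lemma solves_ae_const:
  assumes "solves_ae T f (\<lambda>t. 0)" "t \<in> {0..T}"
  shows "f t = f 0"
  using solves_ae_has_integral[OF assms(1), of 0 t] assms(2) has_integral_0_eq by fastforce

text \<open>A continuous derivative is bounded on the compact interval, so \<open>f\<close> is
  Lipschitz and \<open>e / B\<close> serves as the \<delta> of absolute continuity.\<close>

lemma solves_aeI:
  assumes der: "\<And>t. t \<in> {0..T} \<Longrightarrow> (f has_real_derivative g t) (at t within {0..T})"
    and g: "continuous_on {0..T} g"
  shows "solves_ae T f g"
proof -
  obtain B where "B > 0" and B: "\<And>t. t \<in> {0..T} \<Longrightarrow> \<bar>g t\<bar> \<le> B"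
    using compact_imp_bounded[OF compact_continuous_image[OF g compact_Icc]]
    unfolding bounded_pos by auto
  have lip: "\<bar>f t - f s\<bar> \<le> B * (t - s)" if "0 \<le> s" "s \<le> t" "t \<le> T" for s t
    using field_differentiable_bound[of "{0..T}" f g B t s] der B that by auto
  have "abs_cont_on 0 T f"
    unfolding abs_cont_on_def
  proof (intro allI impI)
    fix e :: real assume "e > 0"
    show "\<exists>\<delta>>0. \<forall>D. finite D \<and> (\<forall>(s, t)\<in>D. 0 \<le> s \<and> s \<le> t \<and> t \<le> T) \<and>
        disjoint_family_on (\<lambda>(s, t). {s<..<t}) D \<and> (\<Sum>(s, t)\<in>D. t - s) < \<delta> \<longrightarrow>
        (\<Sum>(s, t)\<in>D. \<bar>f t - f s\<bar>) < e"
    proof (intro exI[of _ "e / B"] conjI allI impI, goal_cases)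
      case (2 D)
      have "(\<Sum>(s, t)\<in>D. \<bar>f t - f s\<bar>) \<le> (\<Sum>(s, t)\<in>D. B * (t - s))"
        by (rule sum_mono) (use 2 lip in fastforce)
      also have "\<dots> = B * (\<Sum>(s, t)\<in>D. t - s)"
        by (simp add: sum_distrib_left split_def)
      also have "\<dots> < e"
        using 2 \<open>B > 0\<close> by (simp add: field_simps)
      finally show ?case .
    qed (use \<open>e > 0\<close> \<open>B > 0\<close> in simp)
  qed
  moreover have "AE t in lebesgue_on {0..T}. (f has_real_derivative g t) (at t within {0..T})"
    using der by (intro AE_I2) auto
  ultimately show ?thesis unfolding solves_ae_def by blast
qed

section \<open>Steering by a turn, a segment and a turn\<close>

lemma has_real_derivative_max_0_power2:
  "((\<lambda>x::real. (max 0 x)\<^sup>2) has_real_derivative 2 * max 0 x) (at x)"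
proof -
  consider "x < 0" | "x = 0" | "x > 0" by linarith
  then show ?thesis
  proof cases
    case 1
    have "((\<lambda>x::real. 0) has_real_derivative 2 * max 0 x) (at x)" using 1 by simp
    then show ?thesis
      by (rule has_field_derivative_transform_within_open[of _ _ _ "{..<0}"]) (use 1 in auto)
  next
    case 2
    \<comment> \<open>At the kink the difference quotient is squeezed between
      \<open>- \<bar>h\<bar>\<close> and \<open>\<bar>h\<bar>\<close>.\<close>
    have "((\<lambda>h. (max 0 h)\<^sup>2 / h) \<longlongrightarrow> 0) (at (0::real))"
    proof (rule tendsto_sandwich)
      show "\<forall>\<^sub>F h in at (0::real). - \<bar>h\<bar> \<le> (max 0 h)\<^sup>2 / h" "\<forall>\<^sub>F h in at (0::real). (max 0 h)\<^sup>2 / h \<le> \<bar>h\<bar>"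
        by (auto intro!: always_eventually simp: max_def power2_eq_square)
    qed (auto intro!: tendsto_eq_intros)
    then show ?thesis using 2 by (simp add: DERIV_def)
  next
    case 3
    have "((\<lambda>x::real. x\<^sup>2) has_real_derivative 2 * max 0 x) (at x)"
      using 3 by (auto intro!: derivative_eq_intros)
    then show ?thesis
      by (rule has_field_derivative_transform_within_open[of _ _ _ "{0<..}"]) (use 3 in auto)
  qed
qed

lemma has_real_derivative_max_0_power3:
  "((\<lambda>x::real. max 0 x ^ 3) has_real_derivative 3 * (max 0 x)\<^sup>2) (at x)"
proof -
  have "((\<lambda>x::real. x * (max 0 x)\<^sup>2) has_real_derivative 3 * (max 0 x)\<^sup>2) (at x)"
    by (rule derivative_eq_intros has_real_derivative_max_0_power2 refl)+
       (auto simp: max_def power2_eq_square)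
  moreover have "x * (max 0 x)\<^sup>2 = max 0 x ^ 3" for x :: real
    by (auto simp: max_def power2_eq_square power3_eq_cube)
  ultimately show ?thesis by simp
qed

text \<open>B-splines with nodes 0, 1, 2, 3: \<open>spline 3\<close> climbs from 0 to 1 on \<open>[0, 3]\<close>, and its first two
  derivatives \<open>spline 2\<close> and \<open>spline 1\<close> are continuous and vanish outside \<open>[0, 3]\<close>.\<close>

definition spline :: "nat \<Rightarrow> real \<Rightarrow> real" where
  "spline n t = (max 0 t ^ n - 3 * max 0 (t - 1) ^ n + 3 * max 0 (t - 2) ^ n - max 0 (t - 3) ^ n) / fact n"

lemma spline_has_derivative:
  "(spline 3 has_real_derivative spline 2 t) (at t within A)"
  "(spline 2 has_real_derivative spline 1 t) (at t within A)"
proof -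
  note 3 = DERIV_chain2[OF has_real_derivative_max_0_power3]
  note 2 = DERIV_chain2[OF has_real_derivative_max_0_power2]
  have "(spline 3 has_real_derivative spline 2 t) (at t)"
    unfolding spline_def[abs_def]
    by (rule derivative_eq_intros 3 refl | simp add: fact_numeral)+
  then show "(spline 3 has_real_derivative spline 2 t) (at t within A)"
    by (rule has_field_derivative_at_within)
  have "(spline 2 has_real_derivative spline 1 t) (at t)"
    unfolding spline_def[abs_def]
    by (rule derivative_eq_intros 2 refl | simp add: fact_numeral)+
  then show "(spline 2 has_real_derivative spline 1 t) (at t within A)"
    by (rule has_field_derivative_at_within)
qed

lemma continuous_on_spline [continuous_intros]:
  "continuous_on A f \<Longrightarrow> continuous_on A (\<lambda>x. spline n (f x))"
  unfolding spline_def by (intro continuous_intros) auto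

lemma spline_before: "n > 0 \<Longrightarrow> t \<le> 0 \<Longrightarrow> spline n t = 0"
  by (simp add: spline_def)

text \<open>Beyond 3 no truncation is active, and the numerator is the third backward difference of
  \<open>t ^ n\<close>: it equals 3! for \<open>n = 3\<close> and vanishes for smaller
  \<open>n\<close>.\<close>

lemma spline_after:
  assumes "t \<ge> 3"
  shows "spline 3 t = 1" "spline 2 t = 0" "spline (Suc 0) t = 0"
  using assms by (simp_all add: spline_def fact_numeral max_def, simp_all add: power2_eq_square power3_eq_cube algebra_simps)

lemma spline_bounded: "\<exists>b>0. \<forall>t. \<bar>spline 2 t\<bar> \<le> b \<and> \<bar>spline 1 t\<bar> \<le> b"
proof -
  have "\<exists>b>0. \<forall>t\<in>{0..3}. \<bar>spline n t\<bar> \<le> b" for n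
    using compact_imp_bounded[OF compact_continuous_image[OF continuous_on_spline[OF continuous_on_id] compact_Icc], of n 0 3]
    unfolding bounded_pos by auto
  then obtain b1 b2 where b: "b1 > 0" "b2 > 0" "\<forall>t\<in>{0..3}. \<bar>spline 1 t\<bar> \<le> b1" "\<forall>t\<in>{0..3}. \<bar>spline 2 t\<bar> \<le> b2"
    by meson
  have "\<bar>spline 2 t\<bar> \<le> b1 + b2 \<and> \<bar>spline 1 t\<bar> \<le> b1 + b2" for t
  proof (cases "t \<in> {0..3}")
    case True
    with b show ?thesis by force
  next
    case False
    then have "spline 2 t = 0 \<and> spline 1 t = 0"
      using spline_before[of _ t] spline_after[of t] by fastforce
    with b show ?thesis by simp
  qed
  with b(1,2) show ?thesis by (intro exI[of _ "b1 + b2"]) auto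
qed

text \<open>For \<open>f\<close> the cosine or the sine, a component of the displacement during a
  turn from heading \<open>a\<close> to heading \<open>b\<close> in time 3.\<close>

definition turn_int :: "(real \<Rightarrow> real) \<Rightarrow> real \<Rightarrow> real \<Rightarrow> real" where
  "turn_int f a b = integral {0..3} (\<lambda>t. f (a + (b - a) * spline 3 t))"

lemma turn_int_bound:
  assumes "continuous_on UNIV f" "\<And>t. \<bar>f t\<bar> \<le> 1"
  shows "\<bar>turn_int f a b\<bar> \<le> 3"
proof -
  have "norm (integral (cbox 0 3) (\<lambda>t. f (a + (b - a) * spline 3 t))) \<le> 1 * Sigma_Algebra.measure lborel (cbox 0 (3::real))"
    by (rule integrable_bound)
       (use assms(2) in \<open>auto intro!: integrable_continuous_real continuous_intros continuous_on_compose2[OF assms(1)]\<close>)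
  then show ?thesis by (simp add: turn_int_def)
qed

lemma continuous_on_turn_int:
  assumes f: "continuous_on UNIV f" and ab: "continuous_on A a" "continuous_on A b"
  shows "continuous_on A (\<lambda>s. turn_int f (a s) (b s))"
proof -
  have "continuous_on (A \<times> cbox 0 3) (\<lambda>(s, t). f (a s + (b s - a s) * spline 3 t))"
    unfolding split_def
    by (intro continuous_intros continuous_on_compose2[OF f] continuous_on_compose2[OF ab(1)]
        continuous_on_compose2[OF ab(2)]) auto
  then show ?thesis
    unfolding turn_int_def using integral_continuous_on_param by fastforce
qed

text \<open>The prefix \<open>tlt\<close> stands for turn, line, turn: from heading \<open>\<pi> / 2\<close> to \<open>\<beta>\<close> in time 3, straight
  on for time \<open>L\<close>, then from \<open>\<beta>\<close> to \<open>\<gamma>\<close> in time 3.\<close>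

context
  fixes \<beta> \<gamma> L :: real
  assumes L: "L \<ge> 0"
begin

definition tlt_angle :: "real \<Rightarrow> real" where
  "tlt_angle t = pi / 2 + (\<beta> - pi / 2) * spline 3 t + (\<gamma> - \<beta>) * spline 3 (t - (3 + L))"

definition tlt_curv :: "real \<Rightarrow> real" where
  "tlt_curv t = (\<beta> - pi / 2) * spline 2 t + (\<gamma> - \<beta>) * spline 2 (t - (3 + L))"

definition tlt_control :: "real \<Rightarrow> real" where
  "tlt_control t = (\<beta> - pi / 2) * spline 1 t + (\<gamma> - \<beta>) * spline 1 (t - (3 + L))"

text \<open>Used with cosine and sine, it gives the end point of the path. Each spline is constant
  outside its own turn, so only one of them varies on each piece, and none on the segment.\<close>

lemma tlt_integral:
  assumes f: "continuous_on UNIV f"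
  shows "integral {0..6 + L} (\<lambda>t. f (tlt_angle t)) = turn_int f (pi / 2) \<beta> + L * f \<beta> + turn_int f \<beta> \<gamma>"
proof -
  have cont: "continuous_on A (\<lambda>t. f (tlt_angle t))" for A
    unfolding tlt_angle_def by (intro continuous_intros continuous_on_compose2[OF f]) auto
  have int: "(\<lambda>t. f (tlt_angle t)) integrable_on {a..b}" for a b
    by (rule integrable_continuous_real[OF cont])
  have 1: "integral {0..3} (\<lambda>t. f (tlt_angle t)) = turn_int f (pi / 2) \<beta>"
    unfolding turn_int_def tlt_angle_def using L by (intro integral_cong) (simp add: spline_before)
  have 2: "integral {3..3 + L} (\<lambda>t. f (tlt_angle t)) = L * f \<beta>"
  proof -
    have "integral {3..3 + L} (\<lambda>t. f (tlt_angle t)) = integral {3..3 + L} (\<lambda>t. f \<beta>)"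
      unfolding tlt_angle_def by (intro integral_cong) (simp add: spline_before spline_after)
    then show ?thesis using L by simp
  qed
  have "((\<lambda>t. f (\<beta> + (\<gamma> - \<beta>) * spline 3 t)) has_integral turn_int f \<beta> \<gamma>) {0..3}"
    unfolding turn_int_def
    by (intro integrable_integral integrable_continuous_real continuous_intros continuous_on_compose2[OF f]) auto
  from has_integral_shift_real_ivl[OF this, of "- (3 + L)"]
  have "((\<lambda>t. f (\<beta> + (\<gamma> - \<beta>) * spline 3 (t - (3 + L)))) has_integral turn_int f \<beta> \<gamma>) {3 + L..6 + L}"
    by (simp add: algebra_simps)
  then have "((\<lambda>t. f (tlt_angle t)) has_integral turn_int f \<beta> \<gamma>) {3 + L..6 + L}"
    by (rule has_integral_eq[rotated]) (use L in \<open>simp add: tlt_angle_def spline_after\<close>)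
  then have 3: "integral {3 + L..6 + L} (\<lambda>t. f (tlt_angle t)) = turn_int f \<beta> \<gamma>"
    by (rule integral_unique)
  have "integral {0..6 + L} (\<lambda>t. f (tlt_angle t)) = integral {0..3} (\<lambda>t. f (tlt_angle t))
    + integral {3..3 + L} (\<lambda>t. f (tlt_angle t)) + integral {3 + L..6 + L} (\<lambda>t. f (tlt_angle t))"
    using Henstock_Kurzweil_Integration.integral_combine[OF _ _ int, of 0 "3 + L" "6 + L"]
      Henstock_Kurzweil_Integration.integral_combine[OF _ _ int, of 0 3 "3 + L"] L
    by simp
  then show ?thesis by (simp add: 1 2 3)
qed

lemma tlt_steers:
  assumes "q > 0"
  shows "steers q start_state (turn_int cos (pi / 2) \<beta> + L * cos \<beta> + turn_int cos \<beta> \<gamma>,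
     turn_int sin (pi / 2) \<beta> + L * sin \<beta> + turn_int sin \<beta> \<gamma>, \<gamma>, 0) (6 + L) tlt_control
     (\<lambda>t. integral {0..t} (\<lambda>t. cos (tlt_angle t))) (\<lambda>t. integral {0..t} (\<lambda>t. sin (tlt_angle t)))
     tlt_angle tlt_curv"
proof -
  have c: "continuous_on A tlt_angle" "continuous_on A tlt_curv" "continuous_on A tlt_control" for A
    unfolding tlt_angle_def[abs_def] tlt_curv_def[abs_def] tlt_control_def[abs_def]
    by (intro continuous_intros)+
  note ch = DERIV_chain2[OF spline_has_derivative(1)] DERIV_chain2[OF spline_has_derivative(2)]
  have th: "solves_ae (6 + L) tlt_angle tlt_curv"
  proof (rule solves_aeI[OF _ c(2)])
    show "(tlt_angle has_real_derivative tlt_curv t) (at t within {0..6 + L})" for t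
      unfolding tlt_angle_def[abs_def] tlt_curv_def
      by (rule derivative_eq_intros ch refl | simp)+
  qed
  have ka: "solves_ae (6 + L) tlt_curv tlt_control"
  proof (rule solves_aeI[OF _ c(3)])
    show "(tlt_curv has_real_derivative tlt_control t) (at t within {0..6 + L})" for t
      unfolding tlt_curv_def[abs_def] tlt_control_def
      by (rule derivative_eq_intros ch refl | simp)+
  qed
  have xy: "solves_ae (6 + L) (\<lambda>t. integral {0..t} (\<lambda>t. cos (tlt_angle t))) (\<lambda>t. cos (tlt_angle t))"
     "solves_ae (6 + L) (\<lambda>t. integral {0..t} (\<lambda>t. sin (tlt_angle t))) (\<lambda>t. sin (tlt_angle t))"
    by (intro solves_aeI integral_has_real_derivative continuous_intros c; assumption)+
  have control: "control q (6 + L) tlt_control"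
    unfolding control_def
  proof (intro conjI)
    show "tlt_control \<in> borel_measurable (lebesgue_on {0..6 + L})"
      by (intro continuous_imp_measurable_on_sets_lebesgue c) auto
    show "integrable (lebesgue_on {0..6 + L}) (\<lambda>t. \<bar>tlt_control t\<bar> powr q)"
      by (intro continuous_imp_integrable_real continuous_on_powr' continuous_intros c) (use assms in auto)
  qed (use L in auto)
  have ends: "tlt_angle 0 = pi / 2" "tlt_angle (6 + L) = \<gamma>" "tlt_curv 0 = 0" "tlt_curv (6 + L) = 0"
    using L by (simp_all add: tlt_angle_def tlt_curv_def spline_before spline_after)
  show ?thesis
    using th ka xy control tlt_integral[of cos] tlt_integral[of sin]
    by (simp add: steers_def trajectory_def same_state_def start_state_def ends continuous_on_cos continuous_on_sin)
qed

text \<open>On the segment curvature and control vanish and the running cost is exactly 1; only the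
  turns, of total duration 6, cost up to \<open>M\<close> more per unit of time. So \<open>L\<close>
  enters with coefficient 1, as the comparison with the distance requires.\<close>

lemma tlt_cost:
  assumes cont: "continuous_on UNIV \<phi>" "continuous_on UNIV \<psi>" and zero: "\<phi> 0 = 0" "\<psi> 0 = 0"
    and M: "\<And>t. \<phi> (tlt_curv t) + \<psi> (tlt_control t) \<le> M"
  shows "cost \<phi> \<psi> (6 + L) tlt_control tlt_curv \<le> ennreal (L + 6 + 6 * M)"
proof -
  \<comment> \<open>At time -1 curvature and control vanish, so the bound there reads
    \<open>0 \<le> M\<close>.\<close>
  have "M \<ge> 0"
    using M[of "-1"] zero L by (simp add: tlt_curv_def tlt_control_def spline_before)
  let ?A = "{0..3} \<union> {3 + L..6 + L}"
  let ?\<mu> = "lebesgue_on {0..6 + L}"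
  have "cost \<phi> \<psi> (6 + L) tlt_control tlt_curv \<le>
    (\<integral>\<^sup>+ t. ennreal 1 + (ennreal M * indicator {0..3} t + ennreal M * indicator {3 + L..6 + L} t) \<partial>?\<mu>)"
    unfolding cost_def
  proof (rule nn_integral_mono)
    fix t assume "t \<in> space ?\<mu>"
    consider "t \<in> ?A" | "t \<le> 0 \<or> t \<in> {3..3+L} \<or> t \<ge> 6 + L" by fastforce
    then show "ennreal (1 + \<phi> (tlt_curv t) + \<psi> (tlt_control t)) \<le>
      ennreal 1 + (ennreal M * indicator {0..3} t + ennreal M * indicator {3 + L..6 + L} t)"
    proof cases
      case 1
      have "ennreal (1 + \<phi> (tlt_curv t) + \<psi> (tlt_control t)) \<le> ennreal (1 + M)"
        using M[of t] by (intro ennreal_leI) simp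
      also have "\<dots> = ennreal 1 + ennreal M" using \<open>M \<ge> 0\<close> by (subst ennreal_plus) auto
      also have "\<dots> \<le> ennreal 1 + (ennreal M * indicator {0..3} t + ennreal M * indicator {3 + L..6 + L} t)"
        using 1 by (intro add_left_mono) (auto simp: indicator_def)
      finally show ?thesis .
    next
      case 2
      then have "tlt_curv t = 0" "tlt_control t = 0"
        using L by (auto simp: tlt_curv_def tlt_control_def spline_before spline_after)
      then show ?thesis using zero by (simp add: add_increasing2)
    qed
  qed
  also have "\<dots> = ennreal 1 * emeasure ?\<mu> {0..6 + L} + (ennreal M * emeasure ?\<mu> {0..3} + ennreal M * emeasure ?\<mu> {3 + L..6 + L})"
  proof -
    have S: "{0..3} \<in> sets ?\<mu>" "{3 + L..6 + L} \<in> sets ?\<mu>" "space ?\<mu> = {0..6 + L}"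
      using L by (auto simp: sets_restrict_space_iff)
    then have m: "(\<lambda>t. ennreal M * indicator {0..3} t) \<in> borel_measurable ?\<mu>"
        "(\<lambda>t. ennreal M * indicator {3 + L..6 + L} t) \<in> borel_measurable ?\<mu>"
      by (intro borel_measurable_times_ennreal borel_measurable_indicator; simp)+
    show ?thesis
      using S m by (simp only: nn_integral_add nn_integral_cmult_indicator borel_measurable_add
          borel_measurable_const nn_integral_const)
  qed
  also have "\<dots> = ennreal (6 + L) + (ennreal M * ennreal 3 + ennreal M * ennreal 3)"
    using L by (simp add: emeasure_restrict_space)
  also have "\<dots> = ennreal (L + 6 + 6 * M)"
  proof -
    have "ennreal M * ennreal 3 = ennreal (M * 3)"
      using \<open>M \<ge> 0\<close> by (subst ennreal_mult) auto
    then show ?thesis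
      using \<open>M \<ge> 0\<close> L by (simp add: ennreal_plus[symmetric] algebra_simps del: ennreal_plus)
  qed
  finally show ?thesis .
qed

end

section \<open>Reaching a distant point at a cost close to its distance\<close>

lemma abs_cos_sin_comb_le: "\<bar>cos s * a + sin s * b\<bar> \<le> \<bar>a\<bar> + \<bar>b\<bar>" for a b s :: real
proof -
  have "\<bar>cos s * a\<bar> \<le> 1 * \<bar>a\<bar>" "\<bar>sin s * b\<bar> \<le> 1 * \<bar>b\<bar>"
    unfolding abs_mult by (intro mult_right_mono; simp)+
  then show ?thesis by linarith
qed

text \<open>The displacement \<open>(dx, dy)\<close> of the turns depends on the heading \<open>\<beta>\<close> of the segment, which is
  therefore found by the intermediate value theorem.\<close>

lemma ex_straight_heading:
  fixes dx dy :: "real \<Rightarrow> real"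
  assumes cont: "continuous_on UNIV dx" "continuous_on UNIV dy"
    and bd: "\<And>\<beta>. \<bar>dx \<beta>\<bar> \<le> 6" "\<And>\<beta>. \<bar>dy \<beta>\<bar> \<le> 6"
    and r: "r \<ge> 24"
  obtains \<beta> L where "\<bar>\<beta> - \<alpha>\<bar> \<le> pi / 2" "0 \<le> L" "L \<le> r + 12"
    "r * cos \<alpha> = dx \<beta> + L * cos \<beta>" "r * sin \<alpha> = dy \<beta> + L * sin \<beta>"
proof -
  \<comment> \<open>The cross product of the heading with the displacement left to the segment; it
    vanishes when the two are parallel.\<close>
  define F where "F \<beta> = cos \<beta> * (r * sin \<alpha> - dy \<beta>) - sin \<beta> * (r * cos \<alpha> - dx \<beta>)" for \<beta>
  have F: "F \<beta> = r * sin (\<alpha> - \<beta>) + (cos \<beta> * (- dy \<beta>) + sin \<beta> * dx \<beta>)" for \<beta>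
    by (simp add: F_def sin_diff algebra_simps)
  have d: "\<bar>cos \<beta> * (- dy \<beta>) + sin \<beta> * dx \<beta>\<bar> \<le> 12" for \<beta>
    using abs_cos_sin_comb_le[of \<beta> "- dy \<beta>" "dx \<beta>"] bd[of \<beta>] by simp
  have "continuous_on {\<alpha> - pi / 2..\<alpha> + pi / 2} F"
    unfolding F_def[abs_def] by (intro continuous_intros continuous_on_subset[OF cont(1)] continuous_on_subset[OF cont(2)]) auto
  moreover have "F (\<alpha> + pi / 2) \<le> 0" "0 \<le> F (\<alpha> - pi / 2)"
    using d[of "\<alpha> + pi / 2"] d[of "\<alpha> - pi / 2"] r by (simp_all add: F)
  ultimately obtain \<beta> where \<beta>: "\<alpha> - pi / 2 \<le> \<beta>" "\<beta> \<le> \<alpha> + pi / 2" "F \<beta> = 0"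
    using IVT2'[of F "\<alpha> + pi / 2" 0 "\<alpha> - pi / 2"] by auto
  \<comment> \<open>The corresponding dot product, whose sign tells that the segment is run
    forwards. At a zero of \<open>F\<close> the sine is at most 12/\<open>r\<close>, hence at most
    1/2, and the cosine is nonnegative on the half circle searched, so \<open>L\<close> is at least
    \<open>r / 2 - 12\<close>. This is the origin of the bound 24.\<close>
  define L where "L = cos \<beta> * (r * cos \<alpha> - dx \<beta>) + sin \<beta> * (r * sin \<alpha> - dy \<beta>)"
  have L: "L = r * cos (\<alpha> - \<beta>) + (cos \<beta> * (- dx \<beta>) + sin \<beta> * (- dy \<beta>))"
    by (simp add: L_def cos_diff algebra_simps)
  have "\<bar>r * sin (\<alpha> - \<beta>)\<bar> \<le> 12"
    using d[of \<beta>] F[of \<beta>] \<beta>(3) by linarith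
  then have "r * \<bar>sin (\<alpha> - \<beta>)\<bar> \<le> 12" using r by (simp add: abs_mult)
  then have "r * \<bar>sin (\<alpha> - \<beta>)\<bar> \<le> r * (1 / 2)" using r by linarith
  then have "\<bar>sin (\<alpha> - \<beta>)\<bar> \<le> 1 / 2" using r by (subst (asm) mult_le_cancel_left) simp
  then have "(sin (\<alpha> - \<beta>))\<^sup>2 \<le> (1 / 2)\<^sup>2" using power_mono[of "\<bar>sin (\<alpha> - \<beta>)\<bar>" "1 / 2" 2] by simp
  then have "(1 / 2)\<^sup>2 \<le> (cos (\<alpha> - \<beta>))\<^sup>2"
    by (simp add: cos_squared_eq power_divide)
  moreover have "cos (\<alpha> - \<beta>) \<ge> 0" using \<beta> by (intro cos_ge_zero) auto
  ultimately have "cos (\<alpha> - \<beta>) \<ge> 1 / 2" using power2_le_imp_le by blast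
  then have c: "r * cos (\<alpha> - \<beta>) \<ge> r * (1 / 2)" "r * cos (\<alpha> - \<beta>) \<le> r * 1"
    using r by (intro mult_left_mono; simp)+
  have "\<bar>cos \<beta> * (- dx \<beta>) + sin \<beta> * (- dy \<beta>)\<bar> \<le> 12"
    using abs_cos_sin_comb_le[of \<beta> "- dx \<beta>" "- dy \<beta>"] bd[of \<beta>] by simp
  with c L r have L0: "0 \<le> L" "L \<le> r + 12" by linarith+
  let ?u = "r * cos \<alpha> - dx \<beta>" and ?v = "r * sin \<alpha> - dy \<beta>"
  have "L * cos \<beta> = ?u * ((cos \<beta>)\<^sup>2 + (sin \<beta>)\<^sup>2) + sin \<beta> * F \<beta>"
    "L * sin \<beta> = ?v * ((cos \<beta>)\<^sup>2 + (sin \<beta>)\<^sup>2) - cos \<beta> * F \<beta>"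
    unfolding L_def F_def by algebra+
  then have "L * cos \<beta> = ?u" "L * sin \<beta> = ?v"
    using \<beta>(3) by simp_all
  moreover have "\<bar>\<beta> - \<alpha>\<bar> \<le> pi / 2" using \<beta>(1,2) by linarith
  ultimately show ?thesis
    using L0 by (intro that[of \<beta> L]) simp_all
qed

text \<open>The final heading matters only modulo 2\<pi>, so it may be reduced, and the segment
  heading stays within \<pi>/2 of the reduced angle \<alpha>. Both turning angles are thus bounded
  independently of the final point, and so is the extra cost of the turns. The 18 consists of
  duration 6 for the turns and at most 12 by which the segment exceeds the distance.\<close>

lemma ex_steering_cost_le:
  assumes cont: "continuous_on UNIV \<phi>" "continuous_on UNIV \<psi>" and zero: "\<phi> 0 = 0" "\<psi> 0 = 0"
    and "q > 0"
  shows "\<exists>C. \<forall>x\<^sub>1 y\<^sub>1 \<theta>\<^sub>1. norm (x\<^sub>1, y\<^sub>1) \<ge> 24 \<longrightarrow>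
    (\<exists>T u x y \<theta> \<kappa>. steers q start_state (x\<^sub>1, y\<^sub>1, \<theta>\<^sub>1, 0) T u x y \<theta> \<kappa> \<and>
      cost \<phi> \<psi> T u \<kappa> \<le> ennreal (norm (x\<^sub>1, y\<^sub>1) + C))"
proof -
  obtain b where "b > 0" and b: "\<And>t. \<bar>spline 2 t\<bar> \<le> b" "\<And>t. \<bar>spline 1 t\<bar> \<le> b"
    using spline_bounded by auto
  \<comment> \<open>A common bound for curvature and control: each is a sum of two terms, and
    \<open>5 * pi\<close> generously bounds either turning angle.\<close>
  define B where "B = 10 * pi * b"
  have "\<exists>M>0. \<forall>s\<in>{-B..B}. \<bar>f s\<bar> \<le> M" if "continuous_on UNIV f" for f :: "real \<Rightarrow> real"
    using compact_imp_bounded[OF compact_continuous_image[OF continuous_on_subset[OF that] compact_Icc], of "-B" B]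
    unfolding bounded_pos by auto
  then obtain M1 M2 where M: "\<And>s. \<bar>s\<bar> \<le> B \<Longrightarrow> \<bar>\<phi> s\<bar> \<le> M1" "\<And>s. \<bar>s\<bar> \<le> B \<Longrightarrow> \<bar>\<psi> s\<bar> \<le> M2"
    using cont by (metis abs_le_iff atLeastAtMost_iff minus_le_iff)
  have "\<exists>T u x y \<theta> \<kappa>. steers q start_state (x\<^sub>1, y\<^sub>1, \<theta>\<^sub>1, 0) T u x y \<theta> \<kappa> \<and>
      cost \<phi> \<psi> T u \<kappa> \<le> ennreal (norm (x\<^sub>1, y\<^sub>1) + (18 + 6 * (M1 + M2)))"
    if r: "norm (x\<^sub>1, y\<^sub>1) \<ge> 24" for x\<^sub>1 y\<^sub>1 \<theta>\<^sub>1
  proof -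
    define r where "r = norm (x\<^sub>1, y\<^sub>1)"
    have "r > 0" using r unfolding r_def by linarith
    have "x\<^sub>1\<^sup>2 + y\<^sub>1\<^sup>2 = r\<^sup>2" by (simp add: r_def norm_Pair)
    with \<open>r > 0\<close> have "(x\<^sub>1 / r)\<^sup>2 + (y\<^sub>1 / r)\<^sup>2 = 1" by (simp add: power_divide add_divide_distrib[symmetric])
    then obtain \<alpha> where \<alpha>: "0 \<le> \<alpha>" "\<alpha> < 2 * pi" "x\<^sub>1 = r * cos \<alpha>" "y\<^sub>1 = r * sin \<alpha>"
      using sincos_total_2pi[of "x\<^sub>1 / r" "y\<^sub>1 / r"] \<open>r > 0\<close> by (metis mult.commute nonzero_divide_eq_eq less_irrefl)
    define \<gamma> where "\<gamma> = \<theta>\<^sub>1 rmod (2 * pi)"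
    have \<gamma>: "0 \<le> \<gamma>" "\<gamma> < 2 * pi" "[\<gamma> = \<theta>\<^sub>1] (rmod (2 * pi))"
      by (simp_all add: \<gamma>_def rmod_nonneg rmod_less rcong_rmod_left)
    note tb = turn_int_bound[of cos] turn_int_bound[of sin]
    obtain \<beta> L where \<beta>: "\<bar>\<beta> - \<alpha>\<bar> \<le> pi / 2" and L: "0 \<le> L" "L \<le> r + 12"
      and xy: "r * cos \<alpha> = (turn_int cos (pi / 2) \<beta> + turn_int cos \<beta> \<gamma>) + L * cos \<beta>"
        "r * sin \<alpha> = (turn_int sin (pi / 2) \<beta> + turn_int sin \<beta> \<gamma>) + L * sin \<beta>"
    proof (rule ex_straight_heading[of "\<lambda>\<beta>. turn_int cos (pi / 2) \<beta> + turn_int cos \<beta> \<gamma>"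
          "\<lambda>\<beta>. turn_int sin (pi / 2) \<beta> + turn_int sin \<beta> \<gamma>" r \<alpha>])
      show "\<bar>turn_int cos (pi / 2) \<beta> + turn_int cos \<beta> \<gamma>\<bar> \<le> 6"
        "\<bar>turn_int sin (pi / 2) \<beta> + turn_int sin \<beta> \<gamma>\<bar> \<le> 6" for \<beta>
        using tb[of "pi / 2" \<beta>] tb[of \<beta> \<gamma>] by (simp_all add: continuous_intros)
    qed (use r in \<open>auto simp: r_def intro!: continuous_intros continuous_on_turn_int\<close>)
    have bd: "\<bar>(\<beta> - pi / 2) * s + (\<gamma> - \<beta>) * s'\<bar> \<le> B" if "\<bar>s\<bar> \<le> b" "\<bar>s'\<bar> \<le> b" for s s'
    proof -
      have "\<bar>\<beta> - pi / 2\<bar> \<le> 5 * pi" "\<bar>\<gamma> - \<beta>\<bar> \<le> 5 * pi"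
        using \<beta> \<alpha>(1,2) \<gamma>(1,2) pi_gt_zero by linarith+
      then have "\<bar>(\<beta> - pi / 2) * s\<bar> \<le> 5 * pi * b" "\<bar>(\<gamma> - \<beta>) * s'\<bar> \<le> 5 * pi * b"
        unfolding abs_mult using that by (intro mult_mono; simp)+
      then show ?thesis unfolding B_def by linarith
    qed
    have "\<phi> (tlt_curv \<beta> \<gamma> L t) + \<psi> (tlt_control \<beta> \<gamma> L t) \<le> M1 + M2" for t
      using M(1)[OF bd[OF b(1) b(1)], of t "t - (3 + L)"] M(2)[OF bd[OF b(2) b(2)], of t "t - (3 + L)"]
      unfolding tlt_curv_def[OF L(1)] tlt_control_def[OF L(1)] by linarith
    from tlt_cost[OF L(1) cont zero this]
    have "cost \<phi> \<psi> (6 + L) (tlt_control \<beta> \<gamma> L) (tlt_curv \<beta> \<gamma> L) \<le> ennreal (L + 6 + 6 * (M1 + M2))" .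
    also have "\<dots> \<le> ennreal (r + (18 + 6 * (M1 + M2)))"
      using L by (intro ennreal_leI) simp
    finally have "cost \<phi> \<psi> (6 + L) (tlt_control \<beta> \<gamma> L) (tlt_curv \<beta> \<gamma> L) \<le> ennreal (r + (18 + 6 * (M1 + M2)))" .
    moreover have "x\<^sub>1 = turn_int cos (pi / 2) \<beta> + L * cos \<beta> + turn_int cos \<beta> \<gamma>"
      "y\<^sub>1 = turn_int sin (pi / 2) \<beta> + L * sin \<beta> + turn_int sin \<beta> \<gamma>"
      using \<alpha>(3,4) xy by simp_all
    moreover note tlt_steers[OF L(1) \<open>q > 0\<close>, of \<beta> \<gamma>]
    moreover have "steers q start_state (x\<^sub>1, y\<^sub>1, \<theta>\<^sub>1, 0) T u x y \<theta> \<kappa>"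
      if "steers q start_state (x\<^sub>1, y\<^sub>1, \<gamma>, 0) T u x y \<theta> \<kappa>" for T u x y \<theta> \<kappa>
      using that \<gamma>(3) rcong_trans by (auto simp: steers_def same_state_def)
    ultimately show ?thesis
      unfolding r_def by metis
  qed
  then show ?thesis by blast
qed

section \<open>Properties of the cost\<close>

lemma C2_derivs:
  assumes "C2 f"
  shows "(f has_real_derivative deriv f r) (at r within A)"
    and "continuous_on A f" "continuous_on A (deriv f)"
proof -
  have d: "(f has_real_derivative deriv f r) (at r)" "(deriv f has_real_derivative deriv (deriv f) r) (at r)" for r
    using assms unfolding C2_def DERIV_deriv_iff_field_differentiable by blast+
  show "(f has_real_derivative deriv f r) (at r within A)"
    using d(1) by (rule has_field_derivative_at_within)
  show "continuous_on A f" "continuous_on A (deriv f)"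
    using d has_field_derivative_at_within by (blast intro: DERIV_continuous_on)+
qed

lemma deriv_even:
  assumes "C2 f" "even_fun f"
  shows "deriv f (- r) = - deriv f r"
proof -
  have "((\<lambda>r. f (- r)) has_real_derivative deriv f (- r) * - 1) (at r)"
    by (rule DERIV_chain2[OF C2_derivs(1)[OF assms(1)]]) (auto intro!: derivative_eq_intros)
  moreover have "(\<lambda>r. f (- r)) = f" using assms(2) by (auto simp: even_fun_def)
  ultimately show ?thesis
    using DERIV_unique[OF C2_derivs(1)[OF assms(1), of r UNIV]] by fastforce
qed

text \<open>0 is the midpoint of \<open>- r\<close> and \<open>r\<close>, where \<open>f\<close>
  takes equal values.\<close>

lemma strictly_convex_even_pos:
  assumes "strictly_convex f" "even_fun f" "f 0 = 0" "r \<noteq> 0"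
  shows "f r > 0"
proof -
  have "f ((1 - 1/2) * (- r) + 1/2 * r) < (1 - 1/2) * f (- r) + 1/2 * f r"
    using assms(1)[unfolded strictly_convex_def, rule_format, of "- r" r "1/2"] assms(4) by auto
  then show ?thesis using assms by (simp add: even_fun_def)
qed

text \<open>Beyond \<open>h\<close> the chord from the origin gives
  \<open>f r / \<bar>r\<bar> > f h / h\<close>. Applied to \<psi>, this bounds the integral of the
  absolute value of \<open>u\<close> by that of \<open>\<psi> (u)\<close>, up to an error
  \<open>h\<close> per unit of time that can be chosen freely.\<close>

lemma strictly_convex_ge_linear:
  assumes cv: "strictly_convex f" and ev: "even_fun f" and f0: "f 0 = 0" and h: "h > 0"
  shows "\<bar>r\<bar> \<le> h + h / f h * f r"
proof -
  have fh: "f h > 0" using strictly_convex_even_pos[OF cv ev f0] h by simp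
  have fr: "f r \<ge> 0" using strictly_convex_even_pos[OF cv ev f0, of r] f0 by (cases "r = 0") auto
  have f_abs: "f \<bar>r\<bar> = f r" using ev by (simp add: abs_if even_fun_def)
  show ?thesis
  proof (cases "\<bar>r\<bar> \<le> h")
    case True
    then show ?thesis using fh fr h by (simp add: add_increasing2)
  next
    case False
    with h have "f ((1 - h / \<bar>r\<bar>) * 0 + h / \<bar>r\<bar> * \<bar>r\<bar>) < (1 - h / \<bar>r\<bar>) * f 0 + h / \<bar>r\<bar> * f \<bar>r\<bar>"
      using cv[unfolded strictly_convex_def, rule_format, of 0 "\<bar>r\<bar>" "h / \<bar>r\<bar>"] by auto
    then have "f h < h / \<bar>r\<bar> * f r" using False h f0 f_abs by auto
    then have "\<bar>r\<bar> < h / f h * f r" using False h fh by (auto simp: field_simps)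
    then show ?thesis using h by simp
  qed
qed

text \<open>Surjectivity makes \<open>inv\<close> a right inverse, so that \<open>p\<^sub>4\<close>
  can be recovered from \<open>u\<close>. Superlinear growth and the mean value theorem give
  arbitrarily large slopes, oddness of the derivative gives arbitrarily negative ones, and
  continuity fills the range.\<close>

lemma surj_deriv_superlinear:
  fixes f :: "real \<Rightarrow> real"
  assumes f: "C2 f" "even_fun f" "f 0 = 0" and "q > 1" "C > 0" "R > 0"
    and growth: "\<And>r. \<bar>r\<bar> \<ge> R \<Longrightarrow> f r \<ge> C * \<bar>r\<bar> powr q"
  shows "surj (deriv f)"
proof -
  have large: "\<exists>r. deriv f r \<ge> m \<and> deriv f (- r) \<le> - m" for m
  proof -
    \<comment> \<open>The solution of \<open>C * r\<^sub>0 powr (q - 1) = \<bar>m\<bar> + 1\<close>;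
      the maximum with \<open>R\<close> enters the range of the growth bound.\<close>
    define r\<^sub>0 where "r\<^sub>0 = ((\<bar>m\<bar> + 1) / C) powr (1 / (q - 1))"
    define r where "r = max R r\<^sub>0"
    have "r\<^sub>0 powr (q - 1) = (\<bar>m\<bar> + 1) / C"
      using \<open>q > 1\<close> \<open>C > 0\<close> by (simp add: r\<^sub>0_def powr_powr)
    moreover have "r\<^sub>0 powr (q - 1) \<le> r powr (q - 1)"
      using \<open>q > 1\<close> by (intro powr_mono2) (auto simp: r_def r\<^sub>0_def)
    ultimately have "(\<bar>m\<bar> + 1) / C \<le> r powr (q - 1)" by simp
    then have r: "C * r powr (q - 1) \<ge> m" "r \<ge> R"
      using \<open>C > 0\<close> by (auto simp: r_def field_simps)
    with \<open>R > 0\<close> have "r > 0" by simp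
    obtain s where s: "f r - f 0 = (r - 0) * deriv f s"
      using MVT2[of 0 r f "deriv f"] \<open>r > 0\<close> C2_derivs(1)[OF f(1)] by blast
    have "r * m \<le> r * (C * r powr (q - 1))" using r \<open>r > 0\<close> by simp
    also have "\<dots> = C * r powr q" using \<open>r > 0\<close> by (simp add: powr_diff)
    also have "\<dots> \<le> f r" using growth[of r] r \<open>r > 0\<close> by simp
    finally have "m \<le> deriv f s" using s f(3) \<open>r > 0\<close> by simp
    then show ?thesis using deriv_even[OF f(1,2)] by auto
  qed
  have "\<exists>s. deriv f s = m" for m
  proof -
    obtain r where "deriv f r \<ge> \<bar>m\<bar>" "deriv f (- r) \<le> - \<bar>m\<bar>" using large by blast
    then have "deriv f (- r) \<le> m" "m \<le> deriv f r" by linarith+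
    moreover have "connected (range (deriv f))"
      using C2_derivs(3)[OF f(1)] by (intro connected_continuous_image) auto
    ultimately have "m \<in> range (deriv f)"
      by (blast intro: connectedD_interval)
    then show ?thesis by auto
  qed
  then show ?thesis unfolding surj_def by metis
qed

section \<open>Adjoint equations near a straight line\<close>

lemma MVT_within:
  fixes f :: "real \<Rightarrow> real"
  assumes st: "a \<le> s" "s < t" "t \<le> b"
    and der: "\<And>r. r \<in> {a..b} \<Longrightarrow> (f has_real_derivative g r) (at r within {a..b})"
  obtains r where "s < r" "r < t" "f t - f s = (t - s) * g r"
proof -
  have "\<exists>r\<in>{s<..<t}. f t - f s = g r * (t - s)"
  proof (rule mvt_simple[OF st(2)])
    fix r assume "s \<le> r" "r \<le> t"
    then have "(f has_real_derivative g r) (at r within {s..t})"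
      using st by (intro has_field_derivative_subset[OF der]) auto
    then show "(f has_derivative (\<lambda>h. g r * h)) (at r within {s..t})"
      by (simp add: has_field_derivative_def)
  qed
  then show ?thesis using that by (auto simp: mult.commute)
qed

text \<open>\<open>A\<close> and \<open>B\<close> are the components of \<open>(p\<^sub>1, p\<^sub>2)\<close> along and across the direction \<open>\<alpha>\<close>, while \<open>w\<close> and
  \<open>c\<close> are the sine and cosine of \<open>\<theta> - \<alpha>\<close>. The term \<open>d\<close> is \<open>\<phi>' (\<kappa>)\<close>; the numbers \<open>k\<close>, \<open>v\<close>, \<open>e\<close>, \<open>f\<close> are the values
  of \<open>\<kappa>\<close>, \<open>u\<close>, \<open>\<phi> (\<kappa>)\<close>, \<open>\<psi> (u)\<close> at \<open>t\<^sub>1\<close>.\<close>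

lemma adjoint_estimate:
  fixes A B \<delta> :: real
  assumes \<delta>: "0 < \<delta>" "\<delta> \<le> 1 / 12"
    and ts: "a \<le> t\<^sub>1" "t\<^sub>1 + 1 / 7 \<le> t\<^sub>2" "t\<^sub>2 + 1 / 7 \<le> t\<^sub>3" "t\<^sub>3 + 1 / 7 \<le> t\<^sub>4" "t\<^sub>4 \<le> b" "b \<le> a + 1"
    and p3: "\<And>t. t \<in> {a..b} \<Longrightarrow> (p\<^sub>3 has_real_derivative A * w t + B * c t) (at t within {a..b})"
    and p4: "\<And>t. t \<in> {a..b} \<Longrightarrow> (p\<^sub>4 has_real_derivative - p\<^sub>3 t + d t) (at t within {a..b})"
    and w: "\<And>t. t \<in> {a..b} \<Longrightarrow> \<bar>w t\<bar> \<le> \<delta>"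
    and c: "\<And>t. t \<in> {a..b} \<Longrightarrow> 1 - \<delta> \<le> c t" "\<And>t. t \<in> {a..b} \<Longrightarrow> c t \<le> 1"
    and d: "\<And>t. t \<in> {a..b} \<Longrightarrow> \<bar>d t\<bar> \<le> \<delta>"
    and p4t: "\<bar>p\<^sub>4 t\<^sub>1\<bar> \<le> \<delta>" "\<bar>p\<^sub>4 t\<^sub>2\<bar> \<le> \<delta>" "\<bar>p\<^sub>4 t\<^sub>3\<bar> \<le> \<delta>" "\<bar>p\<^sub>4 t\<^sub>4\<bar> \<le> \<delta>"
    and small: "\<bar>k\<bar> \<le> \<delta>" "\<bar>v\<bar> \<le> \<delta>" "\<bar>e\<bar> \<le> \<delta>" "\<bar>f\<bar> \<le> \<delta>"
    and H: "A * c t\<^sub>1 - B * w t\<^sub>1 + p\<^sub>3 t\<^sub>1 * k + p\<^sub>4 t\<^sub>1 * v - (1 + e + f) = 0"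
  shows "\<bar>A - 1\<bar> \<le> 2000 * \<delta>" "\<bar>B\<bar> \<le> 2000 * \<delta>"
proof -
  \<comment> \<open>A change of at most 2\<delta> over a length of at least 1/7 forces a slope of at
    most 14\<delta> somewhere, and that slope differs from \<open>- p\<^sub>3\<close> by at most
    \<delta>.\<close>
  have small_p3: "\<exists>r. s < r \<and> r < t \<and> \<bar>p\<^sub>3 r\<bar> \<le> 15 * \<delta>"
    if st: "a \<le> s" "s + 1 / 7 \<le> t" "t \<le> b" "\<bar>p\<^sub>4 s\<bar> \<le> \<delta>" "\<bar>p\<^sub>4 t\<bar> \<le> \<delta>" for s t
  proof -
    have "a \<le> s" "s < t" "t \<le> b" using st by auto
    then obtain r where r: "s < r" "r < t" and eq: "p\<^sub>4 t - p\<^sub>4 s = (t - s) * (- p\<^sub>3 r + d r)"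
      using MVT_within[OF _ _ _ p4] by blast
    have "(1 / 7) * \<bar>- p\<^sub>3 r + d r\<bar> \<le> (t - s) * \<bar>- p\<^sub>3 r + d r\<bar>"
      using st by (intro mult_right_mono) auto
    also have "\<dots> = \<bar>p\<^sub>4 t - p\<^sub>4 s\<bar>" using st by (simp add: eq abs_mult)
    also have "\<dots> \<le> 2 * \<delta>" using st(4,5) by linarith
    finally have "\<bar>- p\<^sub>3 r + d r\<bar> \<le> 14 * \<delta>" by simp
    moreover have "\<bar>d r\<bar> \<le> \<delta>" using d r st by auto
    ultimately show ?thesis using r by (intro exI[of _ r]) linarith
  qed
  obtain s\<^sub>1 where s1: "t\<^sub>1 < s\<^sub>1" "s\<^sub>1 < t\<^sub>2" "\<bar>p\<^sub>3 s\<^sub>1\<bar> \<le> 15 * \<delta>"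
    using small_p3[of t\<^sub>1 t\<^sub>2] ts p4t by auto
  obtain s\<^sub>2 where s2: "t\<^sub>3 < s\<^sub>2" "s\<^sub>2 < t\<^sub>4" "\<bar>p\<^sub>3 s\<^sub>2\<bar> \<le> 15 * \<delta>"
    using small_p3[of t\<^sub>3 t\<^sub>4] ts p4t by auto
  have Aw: "\<bar>A * w r\<bar> \<le> \<bar>A\<bar> * \<delta>" "\<bar>B * w r\<bar> \<le> \<bar>B\<bar> * \<delta>" if "r \<in> {a..b}" for r
    unfolding abs_mult using w[OF that] by (intro mult_left_mono; simp)+
  have "a \<le> s\<^sub>1" "s\<^sub>1 < s\<^sub>2" "s\<^sub>2 \<le> b" using s1 s2 ts by auto
  \<comment> \<open>The gap between \<open>t\<^sub>2\<close> and \<open>t\<^sub>3\<close> separates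
    the two points by at least 1/7, so the slope of \<open>p\<^sub>3\<close> is at most 7 *
    30\<delta> somewhere between them.\<close>
  then obtain r where r: "s\<^sub>1 < r" "r < s\<^sub>2" and eq: "p\<^sub>3 s\<^sub>2 - p\<^sub>3 s\<^sub>1 = (s\<^sub>2 - s\<^sub>1) * (A * w r + B * c r)"
    using MVT_within[OF _ _ _ p3] by blast
  have rI: "r \<in> {a..b}" using r s1 s2 ts by auto
  have "(1 / 7) * \<bar>A * w r + B * c r\<bar> \<le> (s\<^sub>2 - s\<^sub>1) * \<bar>A * w r + B * c r\<bar>"
    using s1 s2 ts by (intro mult_right_mono) auto
  also have "\<dots> = \<bar>p\<^sub>3 s\<^sub>2 - p\<^sub>3 s\<^sub>1\<bar>" using r by (simp add: eq abs_mult)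
  also have "\<dots> \<le> 30 * \<delta>" using s1(3) s2(3) by linarith
  finally have "\<bar>A * w r + B * c r\<bar> \<le> 210 * \<delta>" by simp
  then have "\<bar>B * c r\<bar> \<le> 210 * \<delta> + \<bar>A\<bar> * \<delta>" using Aw[OF rI] by linarith
  moreover have "\<bar>B\<bar> * (1 / 2) \<le> \<bar>B * c r\<bar>"
    unfolding abs_mult using c(1)[OF rI] \<delta> by (intro mult_left_mono) auto
  ultimately have B: "\<bar>B\<bar> \<le> 420 * \<delta> + 2 * (\<bar>A\<bar> * \<delta>)" by linarith
  have "a \<le> t\<^sub>1" "t\<^sub>1 < s\<^sub>1" "s\<^sub>1 \<le> b" using s1 ts by auto
  \<comment> \<open>The Hamiltonian identity is available at \<open>t\<^sub>1\<close>, so the bound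
    on \<open>p\<^sub>3\<close> is carried back there from \<open>s\<^sub>1\<close>. The number
    \<open>A\<close> is still unbounded, hence the terms
    \<open>\<bar>A\<bar> * \<delta>\<close>.\<close>
  then obtain r' where r': "t\<^sub>1 < r'" "r' < s\<^sub>1" and eq': "p\<^sub>3 s\<^sub>1 - p\<^sub>3 t\<^sub>1 = (s\<^sub>1 - t\<^sub>1) * (A * w r' + B * c r')"
    using MVT_within[OF _ _ _ p3] by blast
  have rI': "r' \<in> {a..b}" and tI: "t\<^sub>1 \<in> {a..b}" using r' s1 ts by auto
  have "\<bar>B * c r'\<bar> \<le> \<bar>B\<bar> * 1"
    unfolding abs_mult using c[OF rI'] \<delta> by (intro mult_left_mono) auto
  then have "\<bar>A * w r' + B * c r'\<bar> \<le> \<bar>A\<bar> * \<delta> + \<bar>B\<bar>" using Aw[OF rI'] by linarith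
  then have dp: "\<bar>p\<^sub>3 s\<^sub>1 - p\<^sub>3 t\<^sub>1\<bar> \<le> 1 * (\<bar>A\<bar> * \<delta> + \<bar>B\<bar>)"
    unfolding eq' abs_mult using s1 ts by (intro mult_mono) auto
  have "\<bar>p\<^sub>3 t\<^sub>1\<bar> \<le> \<bar>p\<^sub>3 s\<^sub>1\<bar> + \<bar>p\<^sub>3 s\<^sub>1 - p\<^sub>3 t\<^sub>1\<bar>" by linarith
  also have "\<dots> \<le> 15 * \<delta> + 1 * (\<bar>A\<bar> * \<delta> + \<bar>B\<bar>)"
    using s1(3) dp by (rule add_mono)
  also have "\<dots> \<le> 15 * \<delta> + 1 * (\<bar>A\<bar> * \<delta> + (420 * \<delta> + 2 * (\<bar>A\<bar> * \<delta>)))"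
    using B by (intro add_left_mono mult_left_mono) auto
  finally have p3t: "\<bar>p\<^sub>3 t\<^sub>1\<bar> \<le> 435 * \<delta> + 3 * (\<bar>A\<bar> * \<delta>)" by (simp add: mult_ac)
  have pk: "\<bar>p\<^sub>3 t\<^sub>1 * k\<bar> \<le> (435 * \<delta> + 3 * (\<bar>A\<bar> * \<delta>)) * 1"
    unfolding abs_mult using small(1) \<delta> p3t by (intro mult_mono) auto
  have pv: "\<bar>p\<^sub>4 t\<^sub>1 * v\<bar> \<le> \<delta> * 1"
    unfolding abs_mult using small(2) p4t(1) \<delta> by (intro mult_mono) auto
  have Bw: "\<bar>B * w t\<^sub>1\<bar> \<le> (420 * \<delta> + 2 * (\<bar>A\<bar> * \<delta>)) * 1"
    unfolding abs_mult using B w[OF tI] \<delta> by (intro mult_mono) auto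
  have Ac: "\<bar>A * (1 - c t\<^sub>1)\<bar> \<le> \<bar>A\<bar> * \<delta>"
    unfolding abs_mult using c[OF tI] by (intro mult_left_mono) auto
  have "A - 1 = A * (1 - c t\<^sub>1) + B * w t\<^sub>1 - p\<^sub>3 t\<^sub>1 * k - p\<^sub>4 t\<^sub>1 * v + e + f"
    using H by (simp add: algebra_simps)
  then have "\<bar>A - 1\<bar> \<le> \<bar>A * (1 - c t\<^sub>1)\<bar> + \<bar>B * w t\<^sub>1\<bar> + \<bar>p\<^sub>3 t\<^sub>1 * k\<bar> + \<bar>p\<^sub>4 t\<^sub>1 * v\<bar> + \<bar>e\<bar> + \<bar>f\<bar>"
    by linarith
  also have "\<dots> \<le> \<bar>A\<bar> * \<delta> + (420 * \<delta> + 2 * (\<bar>A\<bar> * \<delta>)) * 1 + (435 * \<delta> + 3 * (\<bar>A\<bar> * \<delta>)) * 1 + \<delta> * 1 + \<delta> + \<delta>"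
    using Ac Bw pk pv small(3,4) by (intro add_mono)
  finally have "\<bar>A - 1\<bar> \<le> 858 * \<delta> + 6 * (\<bar>A\<bar> * \<delta>)" by (simp add: mult_ac)
  \<comment> \<open>Since \<delta> is at most 1/12, six times this error costs at most 6\<delta> and
    half of \<open>\<bar>A - 1\<bar>\<close>. Absorbing the half leaves the bounds 1728\<delta> for
    \<open>A - 1\<close> and 710\<delta> for \<open>B\<close>.\<close>
  moreover have "\<bar>A\<bar> * \<delta> \<le> \<delta> + \<bar>A - 1\<bar> * (1 / 12)"
  proof -
    have "\<bar>A\<bar> * \<delta> \<le> (1 + \<bar>A - 1\<bar>) * \<delta>" using \<delta> by (intro mult_right_mono) auto
    moreover have "\<bar>A - 1\<bar> * \<delta> \<le> \<bar>A - 1\<bar> * (1 / 12)" using \<delta> by (intro mult_left_mono) auto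
    ultimately show ?thesis by (simp add: algebra_simps)
  qed
  moreover have "z \<le> 2000 * \<delta> \<and> b \<le> 2000 * \<delta>"
    if "z \<le> 858 * \<delta> + 6 * m" "m \<le> \<delta> + z * (1 / 12)" "b \<le> 420 * \<delta> + 2 * m" for z m b
    using that \<delta> by linarith
  ultimately show "\<bar>A - 1\<bar> \<le> 2000 * \<delta>" "\<bar>B\<bar> \<le> 2000 * \<delta>"
    using B by blast+
qed

text \<open>The derivative of the tangent is at least 1, and the tangent is odd.\<close>

lemma abs_le_abs_tan:
  fixes x :: real
  assumes "\<bar>x\<bar> < pi / 2"
  shows "\<bar>x\<bar> \<le> \<bar>tan x\<bar>"
proof -
  have *: "x \<le> tan x" if x: "0 < x" "x < pi / 2" for x :: real
  proof -
    have "\<exists>z>0. z < x \<and> tan x - tan 0 = (x - 0) * inverse ((cos z)\<^sup>2)"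
    proof (rule MVT2[OF x(1)])
      fix z assume "0 \<le> z" "z \<le> x"
      then have "cos z \<noteq> 0" using x cos_gt_zero_pi[of z] by auto
      then show "DERIV tan z :> inverse ((cos z)\<^sup>2)" by (rule DERIV_tan)
    qed
    then obtain z where z: "0 < z" "z < x" "tan x = x * inverse ((cos z)\<^sup>2)" by auto
    have "cos z > 0" using x z cos_gt_zero_pi[of z] by auto
    then have "1 \<le> inverse ((cos z)\<^sup>2)" by (intro one_le_inverse) (auto simp: power_le_one)
    then have "x * 1 \<le> x * inverse ((cos z)\<^sup>2)" using x by (intro mult_left_mono) auto
    then show ?thesis using z by simp
  qed
  consider "x = 0" | "x > 0" | "x < 0" by linarith
  then show ?thesis
  proof cases
    case 2
    then show ?thesis using *[of x] assms by linarith
  next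
    case 3
    then show ?thesis using *[of "- x"] assms by simp
  qed simp
qed

text \<open>In the frame of direction \<alpha> the vector is close to (1, 0). Its length lies
  between its first coordinate and the sum of the absolute values of both. As the first coordinate
  is at least 1/2, the angle lies in the right half plane and is at most its tangent in absolute
  value.\<close>

lemma polar_estimate:
  assumes \<epsilon>: "\<epsilon> \<le> 1 / 2" and "\<rho> \<ge> 0"
    and A: "\<bar>\<rho> * cos (\<alpha> - \<beta>) - 1\<bar> \<le> \<epsilon>" and B: "\<bar>\<rho> * sin (\<alpha> - \<beta>)\<bar> \<le> \<epsilon>"
  shows "\<bar>angle_diff \<beta> \<alpha>\<bar> \<le> 2 * \<epsilon>" "\<bar>\<rho> - 1\<bar> \<le> 2 * \<epsilon>"
proof -
  let ?A = "\<rho> * cos (\<alpha> - \<beta>)" and ?B = "\<rho> * sin (\<alpha> - \<beta>)"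
  have \<epsilon>0: "\<epsilon> \<ge> 0" using B by linarith
  have A12: "?A \<ge> 1 / 2" using A \<epsilon> by linarith
  then have "\<rho> > 0" using \<open>\<rho> \<ge> 0\<close> by (cases "\<rho> = 0") auto
  have "\<rho> = ?A * cos (\<alpha> - \<beta>) + ?B * sin (\<alpha> - \<beta>)"
    using sin_cos_squared_add[of "\<alpha> - \<beta>"] by algebra
  also have "\<dots> \<le> \<bar>?A\<bar> * 1 + \<bar>?B\<bar> * 1"
  proof (intro add_mono)
    show "?A * cos (\<alpha> - \<beta>) \<le> \<bar>?A\<bar> * 1"
      by (rule order_trans[OF abs_ge_self]) (subst abs_mult, intro mult_left_mono, simp_all)
    show "?B * sin (\<alpha> - \<beta>) \<le> \<bar>?B\<bar> * 1"
      by (rule order_trans[OF abs_ge_self]) (subst abs_mult, intro mult_left_mono, simp_all)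
  qed
  finally have "\<rho> \<le> 1 + 2 * \<epsilon>" using A B by linarith
  moreover have "\<rho> * cos (\<alpha> - \<beta>) \<le> \<rho> * 1" using \<open>\<rho> \<ge> 0\<close> by (intro mult_left_mono) auto
  ultimately show "\<bar>\<rho> - 1\<bar> \<le> 2 * \<epsilon>" using A \<epsilon>0 by linarith
  define x where "x = angle_diff \<beta> \<alpha>"
  have "cis x = cis (\<beta> - \<alpha>)"
    using cis_Arg[of "cis (\<beta> - \<alpha>)"] by (simp add: x_def angle_diff_def sgn_div_norm)
  then have cs: "cos x = cos (\<alpha> - \<beta>)" "sin x = - sin (\<alpha> - \<beta>)"
    by (metis cis.simps(1) cos_minus minus_diff_eq, metis cis.simps(2) sin_minus minus_diff_eq)
  have x: "- pi < x" "x \<le> pi"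
    using Arg_bounded[of "cis (\<beta> - \<alpha>)"] by (auto simp: x_def angle_diff_def)
  have "cos x > 0" using A12 \<open>\<rho> > 0\<close> cs by (metis half_gt_zero_iff less_le_trans zero_less_mult_pos zero_less_one)
  have xpi: "\<bar>x\<bar> < pi / 2"
  proof (rule ccontr)
    assume "\<not> \<bar>x\<bar> < pi / 2"
    then have "cos \<bar>x\<bar> \<le> 0"
      using x cos_monotone_0_pi_le[of "pi / 2" "\<bar>x\<bar>"] by auto
    then show False using \<open>cos x > 0\<close> by (simp add: abs_if split: if_splits)
  qed
  then have "\<bar>x\<bar> \<le> \<bar>tan x\<bar>" by (rule abs_le_abs_tan)
  also have "\<bar>tan x\<bar> = \<bar>?B\<bar> / ?A"
    using \<open>\<rho> > 0\<close> \<open>cos x > 0\<close> by (simp add: tan_def cs abs_mult)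
  also have "\<dots> \<le> \<epsilon> / (1 / 2)" using A12 B \<epsilon>0 by (intro frac_le) auto
  finally show "\<bar>angle_diff \<beta> \<alpha>\<bar> \<le> 2 * \<epsilon>" by (simp add: x_def)
qed

section \<open>Small excess on a unit interval\<close>

text \<open>Markov's inequality, with a null set avoided. The factor 2 makes the weak comparison of
  integrals contradictory.\<close>

lemma ex_small_point:
  fixes E :: "real \<Rightarrow> real"
  assumes E: "E integrable_on {a..b}" "integral {a..b} E \<le> \<epsilon>" "\<And>t. 0 \<le> E t" and "\<epsilon> > 0"
    and cd: "a \<le> c" "c < d" "d \<le> b" and N: "negligible N"
  obtains t where "t \<in> {c..d}" "t \<notin> N" "E t * (d - c) \<le> 2 * \<epsilon>"
proof -
  have "\<exists>t\<in>{c..d} - N. E t * (d - c) \<le> 2 * \<epsilon>"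
  proof (rule ccontr)
    assume *: "\<not> ?thesis"
    let ?m = "2 * \<epsilon> / (d - c)"
    have "E integrable_on {c..d}"
      using E(1) cd by (auto intro: integrable_on_subinterval)
    then have "(E has_integral integral {c..d} E) {c..d}" by (rule integrable_integral)
    \<comment> \<open>On \<open>N\<close> nothing is known about \<open>E\<close>; giving it the
      value \<open>?m\<close> there makes the comparison valid at every point.\<close>
    then have spike: "((\<lambda>t. if t \<in> N then ?m else E t) has_integral integral {c..d} E) {c..d}"
      by (rule has_integral_spike[OF N, rotated]) auto
    have const: "((\<lambda>t. ?m) has_integral ?m * (d - c)) {c..d}"
      using has_integral_const_real[of ?m c d] cd by (simp add: mult.commute)
    have "?m * (d - c) \<le> integral {c..d} E"
    proof (rule has_integral_le[OF const spike])
      fix t assume "t \<in> {c..d}"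
      with * have "t \<notin> N \<Longrightarrow> 2 * \<epsilon> \<le> E t * (d - c)" by force
      then show "?m \<le> (if t \<in> N then ?m else E t)"
        using cd by (simp add: pos_divide_le_eq)
    qed
    also have "\<dots> \<le> integral {a..b} E"
      using E cd \<open>E integrable_on {c..d}\<close> by (intro integral_subset_le) auto
    finally show False using E(2) cd \<open>\<epsilon> > 0\<close> by simp
  qed
  then show ?thesis using that by auto
qed

text \<open>Pigeonhole principle: \<open>n\<close> consecutive unit intervals fit into
  \<open>{0..T}\<close>, and they cannot all carry more than \<epsilon>.\<close>

lemma ex_unit_interval_small_integral:
  fixes E :: "real \<Rightarrow> real"
  assumes E: "E integrable_on {0..T}" "\<And>t. 0 \<le> E t"
    and n: "0 < n" "real n \<le> T" "integral {0..T} E \<le> real n * \<epsilon>"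
  obtains k where "k < n" "integral {real k..real k + 1} E \<le> \<epsilon>"
proof -
  have "\<exists>k<n. integral {real k..real k + 1} E \<le> \<epsilon>"
  proof (rule ccontr)
    assume *: "\<not> ?thesis"
    have int: "E integrable_on {a..b}" if "0 \<le> a" "b \<le> real n" for a b
      using E(1) n that by (auto intro: integrable_on_subinterval)
    have "real m * \<epsilon> < integral {0..real m} E" if "0 < m" "m \<le> n" for m
      using that
    proof (induction m)
      case (Suc m)
      have "integral {0..real (Suc m)} E = integral {0..real m} E + integral {real m..real m + 1} E"
        using Henstock_Kurzweil_Integration.integral_combine[of 0 "real m" "real (Suc m)" E] int Suc.prems
        by (simp add: add.commute)
      moreover have "\<epsilon> < integral {real m..real m + 1} E" using * Suc.prems by (auto simp: not_le)
      moreover have "real m * \<epsilon> \<le> integral {0..real m} E"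
        using Suc by (cases "m = 0") auto
      ultimately show ?case by (simp add: algebra_simps)
    qed simp
    from this[OF n(1) order_refl] have "real n * \<epsilon> < integral {0..real n} E" .
    also have "\<dots> \<le> integral {0..T} E"
      using E n int by (intro integral_subset_le) auto
    finally show False using n by simp
  qed
  then show ?thesis using that by auto
qed

text \<open>The curvature is bounded without any help from \<phi>. It oscillates by at most
  \<open>2 * h\<close>, and the sine of the heading error is small near both ends; integrating the
  derivative of that sine in between bounds \<kappa> at one point, hence everywhere. Sine and cosine
  are used because the heading is close to \<alpha> only modulo 2\<pi>.\<close>

lemma kinematic_estimate:
  fixes E u \<kappa> \<theta> :: "real \<Rightarrow> real"
  assumes E: "E integrable_on {a..a + 1}" "integral {a..a + 1} E \<le> \<epsilon>" "\<And>t. 1 - cos (\<theta> t - \<alpha>) \<le> E t"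
    and u: "\<And>t. \<bar>u t\<bar> \<le> h + M * E t"
    and const: "0 < \<epsilon>" "0 < h" "h \<le> 1" "0 \<le> M" "M * \<epsilon> \<le> h" "28 * \<epsilon> \<le> h\<^sup>2" "\<epsilon> \<le> 1 / 7"
    and \<theta>: "\<And>t. t \<in> {a..a + 1} \<Longrightarrow> (\<theta> has_real_derivative \<kappa> t) (at t within {a..a + 1})"
    and \<kappa>: "\<And>s t. \<lbrakk>a \<le> s; s \<le> t; t \<le> a + 1\<rbrakk> \<Longrightarrow> (u has_integral \<kappa> t - \<kappa> s) {s..t}"
    and t: "t \<in> {a..a + 1}"
  shows "\<bar>\<kappa> t\<bar> \<le> 10 * h" "\<bar>sin (\<theta> t - \<alpha>)\<bar> \<le> 11 * h" "1 - 11 * h \<le> cos (\<theta> t - \<alpha>)"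
proof -
  have E0: "0 \<le> E t" for t using E(3)[of t] cos_le_one[of "\<theta> t - \<alpha>"] by linarith
  have int: "E integrable_on {s..t}" if "a \<le> s" "t \<le> a + 1" for s t
    using E(1) that by (auto intro: integrable_on_subinterval)
  have int_le: "integral {s..t} E \<le> \<epsilon>" if "a \<le> s" "t \<le> a + 1" for s t
    using integral_subset_le[of "{s..t}" "{a..a+1}" E] int[OF that] E(1,2) E0 that by auto
  have ub: "u t \<le> h + M * E t" "- (h + M * E t) \<le> u t" for t
    using u[of t] by linarith+
  have osc: "\<bar>\<kappa> t - \<kappa> s\<bar> \<le> 2 * h" if st: "a \<le> s" "s \<le> t" "t \<le> a + 1" for s t
  proof -
    let ?I = "h * (t - s) + M * integral {s..t} E"
    have bnd: "((\<lambda>r. h + M * E r) has_integral ?I) {s..t}"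
      using has_integral_const_real[of h s t] st
      by (intro has_integral_add has_integral_mult_right integrable_integral int)
         (simp_all add: mult.commute)
    have "\<kappa> t - \<kappa> s \<le> ?I"
      by (rule has_integral_le[OF \<kappa>[OF st] bnd]) (rule ub)
    moreover have "- ?I \<le> \<kappa> t - \<kappa> s"
      by (rule has_integral_le[OF has_integral_neg[OF bnd] \<kappa>[OF st]]) (rule ub)
    moreover have "h * (t - s) \<le> h * 1" using st const by (intro mult_left_mono) auto
    moreover have "M * integral {s..t} E \<le> M * \<epsilon>"
      using int_le[of s t] st const by (intro mult_left_mono) auto
    ultimately show ?thesis using const(5) by linarith
  qed
  \<comment> \<open>Here 1 - cos is at most 14\<epsilon> and 1 + cos at most 2, which explains the
    condition with 28.\<close>
  have sin_small: "\<bar>sin (\<theta> r - \<alpha>)\<bar> \<le> h" if "E r * (1 / 7) \<le> 2 * \<epsilon>" for r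
  proof -
    have "(sin (\<theta> r - \<alpha>))\<^sup>2 = (1 - cos (\<theta> r - \<alpha>)) * (1 + cos (\<theta> r - \<alpha>))"
      by (simp add: sin_squared_eq power2_eq_square algebra_simps)
    also have "\<dots> \<le> (14 * \<epsilon>) * 2"
    proof (rule mult_mono)
      show "1 - cos (\<theta> r - \<alpha>) \<le> 14 * \<epsilon>" using E(3)[of r] that by linarith
      show "1 + cos (\<theta> r - \<alpha>) \<le> 2" using cos_le_one[of "\<theta> r - \<alpha>"] by linarith
      show "0 \<le> 1 + cos (\<theta> r - \<alpha>)" using cos_ge_minus_one[of "\<theta> r - \<alpha>"] by linarith
    qed (use const in auto)
    also have "\<dots> \<le> h\<^sup>2" using const by simp
    finally show ?thesis using const by (simp add: abs_le_square_iff[symmetric])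
  qed
  obtain s where s: "s \<in> {a..a + 1 / 7}" "E s * (1 / 7) \<le> 2 * \<epsilon>"
    using ex_small_point[OF E(1,2) E0 const(1), of a "a + 1 / 7" "{}"] by auto
  obtain s' where s': "s' \<in> {a + 6 / 7..a + 1}" "E s' * (1 / 7) \<le> 2 * \<epsilon>"
    using ex_small_point[OF E(1,2) E0 const(1), of "a + 6 / 7" "a + 1" "{}"] by auto
  have ss: "a \<le> s" "s \<le> s'" "s' \<le> a + 1" "5 / 7 \<le> s' - s" "s' - s \<le> 1" "s \<le> a + 1" using s s' by auto
  have dsin: "((\<lambda>r. sin (\<theta> r - \<alpha>)) has_real_derivative \<kappa> r * cos (\<theta> r - \<alpha>)) (at r within {a..a + 1})"
    and dcos: "((\<lambda>r. cos (\<theta> r - \<alpha>)) has_real_derivative - (\<kappa> r * sin (\<theta> r - \<alpha>))) (at r within {a..a + 1})"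
    if "r \<in> {a..a + 1}" for r
    using \<theta>[OF that] by (auto intro!: derivative_eq_intros)
  have "continuous_on {a..a + 1} (\<lambda>r. cos (\<theta> r - \<alpha>))"
    using dcos by (rule DERIV_continuous_on)
  then have intcos: "(\<lambda>r. cos (\<theta> r - \<alpha>)) integrable_on {s..s'}"
    using ss by (intro integrable_continuous_real) (auto elim!: continuous_on_subset)
  \<comment> \<open>At least 5/7 - \<epsilon>, because 1 - cos is dominated by
    \<open>E\<close>.\<close>
  define c where "c = integral {s..s'} (\<lambda>r. cos (\<theta> r - \<alpha>))"
  have hc: "((\<lambda>r. cos (\<theta> r - \<alpha>)) has_integral c) {s..s'}"
    unfolding c_def using intcos by (rule integrable_integral)
  have "(s' - s) - c \<le> integral {s..s'} E"
  proof (rule has_integral_le)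
    show "((\<lambda>r. 1 - cos (\<theta> r - \<alpha>)) has_integral (s' - s) - c) {s..s'}"
      using has_integral_diff[OF has_integral_const_real[of 1 s s'] hc] ss by simp
  qed (use E(3) int ss in auto)
  then have c: "1 / 2 \<le> c" using int_le[of s s'] ss const by linarith
  have "((\<lambda>r. \<kappa> r * cos (\<theta> r - \<alpha>)) has_integral sin (\<theta> s' - \<alpha>) - sin (\<theta> s - \<alpha>)) {s..s'}"
  proof (rule fundamental_theorem_of_calculus)
    fix r assume "r \<in> {s..s'}"
    then have "((\<lambda>r. sin (\<theta> r - \<alpha>)) has_real_derivative \<kappa> r * cos (\<theta> r - \<alpha>)) (at r within {s..s'})"
      using ss by (intro has_field_derivative_subset[OF dsin]) auto
    then show "((\<lambda>r. sin (\<theta> r - \<alpha>)) has_vector_derivative \<kappa> r * cos (\<theta> r - \<alpha>)) (at r within {s..s'})"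
      by (simp add: has_real_derivative_iff_has_vector_derivative)
  qed (use ss in auto)
  note diff = has_integral_diff[OF this has_integral_mult_right[OF hc, of "\<kappa> s"]]
  \<comment> \<open>Freezing the curvature at time \<open>s\<close> costs at most
    \<open>2 * h\<close>, and the sine changes by at most another \<open>2 * h\<close>.\<close>
  have "norm (sin (\<theta> s' - \<alpha>) - sin (\<theta> s - \<alpha>) - \<kappa> s * c) \<le> 2 * h * Sigma_Algebra.measure lborel {s..s'}"
  proof (rule has_integral_bound_real[OF _ _ diff])
    show "norm (\<kappa> r * cos (\<theta> r - \<alpha>) - \<kappa> s * cos (\<theta> r - \<alpha>)) \<le> 2 * h" if "r \<in> {s..s'} - {}" for r
    proof -
      have "\<bar>\<kappa> r - \<kappa> s\<bar> * \<bar>cos (\<theta> r - \<alpha>)\<bar> \<le> 2 * h * 1"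
        using osc[of s r] that ss const by (intro mult_mono) auto
      then show ?thesis by (simp add: left_diff_distrib[symmetric] abs_mult)
    qed
  qed (use const in auto)
  moreover have "2 * h * (s' - s) \<le> 2 * h * 1" using ss const by (intro mult_left_mono) auto
  ultimately have "\<bar>\<kappa> s * c\<bar> \<le> 4 * h"
    using sin_small[OF s(2)] sin_small[OF s'(2)] ss by simp
  moreover have "\<bar>\<kappa> s\<bar> * (1 / 2) \<le> \<bar>\<kappa> s * c\<bar>"
    unfolding abs_mult using c by (intro mult_left_mono) auto
  ultimately have \<kappa>s: "\<bar>\<kappa> s\<bar> \<le> 8 * h" by linarith
  \<comment> \<open>The value at \<open>s\<close> plus the oscillation. One more integration over a
    length of at most 1 then gives the constant 11.\<close>
  have \<kappa>10: "\<bar>\<kappa> r\<bar> \<le> 10 * h" if "r \<in> {a..a + 1}" for r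
    using osc[of s r] osc[of r s] \<kappa>s that ss by (cases "s \<le> r") auto
  show "\<bar>\<kappa> t\<bar> \<le> 10 * h" using \<kappa>10[OF t] .
  have sI: "s \<in> {a..a + 1}" and ts: "\<bar>t - s\<bar> \<le> 1" using ss t by auto
  have bnd: "\<bar>\<kappa> r * cos (\<theta> r - \<alpha>)\<bar> \<le> 10 * h" "\<bar>\<kappa> r * sin (\<theta> r - \<alpha>)\<bar> \<le> 10 * h"
    if "r \<in> {a..a + 1}" for r
    using mult_mono[OF \<kappa>10[OF that] abs_cos_le_one, of "\<theta> r - \<alpha>"]
      mult_mono[OF \<kappa>10[OF that] abs_sin_le_one, of "\<theta> r - \<alpha>"] const by (simp_all add: abs_mult)
  have ts10: "10 * h * \<bar>t - s\<bar> \<le> 10 * h * 1"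
    using ts const by (intro mult_left_mono) auto
  have "norm (sin (\<theta> t - \<alpha>) - sin (\<theta> s - \<alpha>)) \<le> 10 * h * norm (t - s)"
    by (rule field_differentiable_bound[OF _ dsin _ t sI]) (use bnd in auto)
  then show "\<bar>sin (\<theta> t - \<alpha>)\<bar> \<le> 11 * h"
    using sin_small[OF s(2)] ts10 by simp
  have "norm (cos (\<theta> t - \<alpha>) - cos (\<theta> s - \<alpha>)) \<le> 10 * h * norm (t - s)"
    by (rule field_differentiable_bound[OF _ dcos _ t sI]) (use bnd in auto)
  moreover have "1 - cos (\<theta> s - \<alpha>) \<le> h"
  proof -
    have "h\<^sup>2 \<le> h" using const by (simp add: power2_eq_square mult_left_le)
    then show ?thesis using E(3)[of s] s(2) const by linarith
  qed
  ultimately show "1 - 11 * h \<le> cos (\<theta> t - \<alpha>)"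
    using ts10 by simp
qed

section \<open>Optimal trajectories\<close>

text \<open>Projecting the displacement onto direction \<alpha> shows that \<open>r\<close> is the
  integral of \<open>cos (\<theta> t - \<alpha>)\<close>; subtracting it from the cost bound leaves
  \<open>C\<close>. Finiteness of the cost supplies the integrability of
  \<open>\<psi> (u t)\<close>, which the integrability of the control does not.\<close>

lemma optimal_trajectory_excess:
  assumes opt: "optimal_trajectory \<phi> \<psi> q (x\<^sub>1, y\<^sub>1, \<theta>\<^sub>1, 0) T u x y \<theta> \<kappa>"
    and \<alpha>: "(x\<^sub>1, y\<^sub>1) = r *\<^sub>R (cos \<alpha>, sin \<alpha>)"
    and nonneg: "\<And>s. 0 \<le> \<phi> s" "\<And>s. 0 \<le> \<psi> s"
    and cont: "continuous_on UNIV \<phi>" "continuous_on UNIV \<psi>"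
    and ex: "\<exists>T u x y \<theta> \<kappa>. steers q start_state (x\<^sub>1, y\<^sub>1, \<theta>\<^sub>1, 0) T u x y \<theta> \<kappa> \<and>
      cost \<phi> \<psi> T u \<kappa> \<le> ennreal (r + C)"
    and rC: "0 \<le> r + C"
  shows "r \<le> T" "(\<lambda>t. 1 - cos (\<theta> t - \<alpha>) + \<phi> (\<kappa> t) + \<psi> (u t)) integrable_on {0..T}"
    "integral {0..T} (\<lambda>t. 1 - cos (\<theta> t - \<alpha>) + \<phi> (\<kappa> t) + \<psi> (u t)) \<le> C"
proof -
  have steers: "steers q start_state (x\<^sub>1, y\<^sub>1, \<theta>\<^sub>1, 0) T u x y \<theta> \<kappa>"
    using opt by (simp add: optimal_trajectory_def)
  then have traj: "control q T u" "solves_ae T x (\<lambda>t. cos (\<theta> t))" "solves_ae T y (\<lambda>t. sin (\<theta> t))"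
      "solves_ae T \<kappa> u" and ends: "x 0 = 0" "y 0 = 0" "x T = x\<^sub>1" "y T = y\<^sub>1"
    by (auto simp: steers_def trajectory_def same_state_def start_state_def)
  have T: "0 < T" and u: "u \<in> borel_measurable (lebesgue_on {0..T})"
    using traj(1) by (auto simp: control_def)
  have "cost \<phi> \<psi> T u \<kappa> \<le> ennreal (r + C)"
    using opt ex unfolding optimal_trajectory_def by (blast intro: order_trans)
  then have nn: "(\<integral>\<^sup>+ t. ennreal (1 + \<phi> (\<kappa> t) + \<psi> (u t)) \<partial>lebesgue_on {0..T}) \<le> ennreal (r + C)"
    by (simp add: cost_def)
  let ?F = "\<lambda>t. 1 + \<phi> (\<kappa> t) + \<psi> (u t)"
  have "(\<lambda>t. \<phi> (\<kappa> t)) \<in> borel_measurable (lebesgue_on {0..T})"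
    by (intro continuous_imp_measurable_on_sets_lebesgue continuous_on_compose2[OF cont(1)]
        solves_ae_continuous_on[OF traj(4)]) auto
  moreover have "(\<lambda>t. \<psi> (u t)) \<in> borel_measurable (lebesgue_on {0..T})"
    using u borel_measurable_continuous_onI[OF cont(2)] by (rule measurable_compose)
  ultimately have "?F \<in> borel_measurable (lebesgue_on {0..T})"
    by (intro borel_measurable_add) auto
  then have int: "integrable (lebesgue_on {0..T}) ?F"
    using nonneg nn by (intro integrableI_nonneg) (auto intro: le_less_trans)
  have "ennreal (integral\<^sup>L (lebesgue_on {0..T}) ?F) \<le> ennreal (r + C)"
    using nn int nonneg by (subst (asm) nn_integral_eq_integral) auto
  \<comment> \<open>\<open>ennreal\<close> truncates negative numbers to 0, so the passage back to
    the reals uses \<open>rC\<close>.\<close>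
  then have LF: "integral\<^sup>L (lebesgue_on {0..T}) ?F \<le> r + C"
    using rC by (simp add: ennreal_le_iff)
  have hF: "(?F has_integral integral\<^sup>L (lebesgue_on {0..T}) ?F) {0..T}"
    using int by (rule has_integral_integral_lebesgue_on) auto
  have "((\<lambda>t. cos (\<theta> t)) has_integral x\<^sub>1) {0..T}" "((\<lambda>t. sin (\<theta> t)) has_integral y\<^sub>1) {0..T}"
    using solves_ae_has_integral[OF traj(2), of 0 T] solves_ae_has_integral[OF traj(3), of 0 T] ends T
    by simp_all
  then have "((\<lambda>t. cos \<alpha> * cos (\<theta> t) + sin \<alpha> * sin (\<theta> t)) has_integral cos \<alpha> * x\<^sub>1 + sin \<alpha> * y\<^sub>1) {0..T}"
    by (intro has_integral_add has_integral_mult_right)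
  moreover have "cos \<alpha> * x\<^sub>1 + sin \<alpha> * y\<^sub>1 = r"
  proof -
    have "x\<^sub>1 = r * cos \<alpha>" "y\<^sub>1 = r * sin \<alpha>" using \<alpha> by simp_all
    then show ?thesis using sin_cos_squared_add2[of \<alpha>] by algebra
  qed
  ultimately have hc: "((\<lambda>t. cos (\<theta> t - \<alpha>)) has_integral r) {0..T}"
    by (simp add: cos_diff mult.commute)
  show "r \<le> T"
  proof -
    have "((\<lambda>t. 1::real) has_integral T) {0..T}"
      using has_integral_const_real[of "1::real" 0 T] T by simp
    from has_integral_le[OF hc this] show ?thesis by simp
  qed
  have "((\<lambda>t. ?F t - cos (\<theta> t - \<alpha>)) has_integral integral\<^sup>L (lebesgue_on {0..T}) ?F - r) {0..T}"
    by (rule has_integral_diff[OF hF hc])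
  moreover have "(\<lambda>t. ?F t - cos (\<theta> t - \<alpha>)) = (\<lambda>t. 1 - cos (\<theta> t - \<alpha>) + \<phi> (\<kappa> t) + \<psi> (u t))"
    by auto
  ultimately have hE: "((\<lambda>t. 1 - cos (\<theta> t - \<alpha>) + \<phi> (\<kappa> t) + \<psi> (u t)) has_integral
      integral\<^sup>L (lebesgue_on {0..T}) ?F - r) {0..T}" by simp
  then show "(\<lambda>t. 1 - cos (\<theta> t - \<alpha>) + \<phi> (\<kappa> t) + \<psi> (u t)) integrable_on {0..T}" by blast
  show "integral {0..T} (\<lambda>t. 1 - cos (\<theta> t - \<alpha>) + \<phi> (\<kappa> t) + \<psi> (u t)) \<le> C"
    using integral_unique[OF hE] LF by simp
qed

text \<open>The filter form lets several smallness conditions share one radius.\<close>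

lemma eventually_small_on_nbhd:
  fixes f :: "real \<Rightarrow> real"
  assumes "continuous_on UNIV f" "f 0 = 0" "\<delta> > 0"
  shows "\<forall>\<^sub>F d in at_right 0. \<forall>r. \<bar>r\<bar> \<le> d \<longrightarrow> \<bar>f r\<bar> \<le> \<delta>"
proof -
  obtain d where "d > 0" and d: "\<And>r. \<bar>r\<bar> < d \<Longrightarrow> \<bar>f r\<bar> < \<delta>"
    using assms(1)[unfolded continuous_on_iff, rule_format, of 0 \<delta>] assms(2,3) by (auto simp: dist_real_def)
  then show ?thesis
    unfolding eventually_at_right_field by (intro exI[of _ d]) (force intro: less_imp_le)
qed

text \<open>Since \<phi> names the curvature cost, the polar angle of the adjoint vector is \<beta>,
  and the growth exponent is \<open>q\<close>. The polar form is required at a single time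
  \<open>t\<close>, because \<open>p\<^sub>1\<close> and \<open>p\<^sub>2\<close> are
  constant.\<close>

theorem proposition3p6:
  fixes \<phi> \<psi> :: "real \<Rightarrow> real" and q C R :: real
  assumes "\<And>r. 0 \<le> \<phi> r" and "\<And>r. 0 \<le> \<psi> r"
    and "even_fun \<phi>" and "even_fun \<psi>"
    and "C2 \<phi>" and "C2 \<psi>"
    and "mono_on {0..} \<phi>" and "mono_on {0..} \<psi>"
    and "\<phi> 0 = 0" and "\<psi> 0 = 0"
    and "strictly_convex \<psi>" and "deriv (deriv \<psi>) 0 > 0"
    and "q > 1" and "C > 0" and "R > 0"
    and "\<And>r. \<bar>r\<bar> \<ge> R \<Longrightarrow> \<psi> r \<ge> C * \<bar>r\<bar> powr q"
  shows "\<forall>\<eta>>0. \<exists>R\<^sub>\<eta>>0. \<forall>x\<^sub>1 y\<^sub>1 \<theta>\<^sub>1 T u x y \<theta> \<kappa> p\<^sub>1 p\<^sub>2 p\<^sub>3 p\<^sub>4.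
    optimal_trajectory \<phi> \<psi> q (x\<^sub>1, y\<^sub>1, \<theta>\<^sub>1, 0) T u x y \<theta> \<kappa> \<longrightarrow>
    norm (x\<^sub>1, y\<^sub>1) \<ge> R\<^sub>\<eta> \<longrightarrow>
    adjoint_vector \<phi> \<psi> T u \<theta> \<kappa> p\<^sub>1 p\<^sub>2 p\<^sub>3 p\<^sub>4 \<longrightarrow>
    (\<forall>\<alpha>\<in>{0..<2 * pi}. \<forall>\<beta>\<in>{0..<2 * pi}. \<forall>\<rho>\<ge>0. \<forall>t\<in>{0..T}.
      (x\<^sub>1, y\<^sub>1) = norm (x\<^sub>1, y\<^sub>1) *\<^sub>R (cos \<alpha>, sin \<alpha>) \<longrightarrow>
      (p\<^sub>1 t, p\<^sub>2 t) = \<rho> *\<^sub>R (cos \<beta>, sin \<beta>) \<longrightarrow>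
      \<bar>angle_diff \<beta> \<alpha>\<bar> \<le> \<eta> \<and> \<bar>\<rho> - 1\<bar> \<le> \<eta>)"
proof (intro allI impI)
  note nonneg = assms(1,2)
  note C2 = assms(5,6)
  note zero = assms(9,10)
  have cont: "continuous_on A \<phi>" "continuous_on A \<psi>" "continuous_on A (deriv \<phi>)" "continuous_on A (deriv \<psi>)" for A
    using C2_derivs(2,3)[OF C2(1)] C2_derivs(2,3)[OF C2(2)] by auto
  have deriv0: "deriv \<phi> 0 = 0" "deriv \<psi> 0 = 0"
    using deriv_even[OF C2(1) assms(3), of 0] deriv_even[OF C2(2) assms(4), of 0] by simp_all
  have surj: "surj (deriv \<psi>)"
    by (rule surj_deriv_superlinear[OF C2(2) assms(4) zero(2) assms(13,14,15,16)])
  have "0 < q" using assms(13) by simp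
  from ex_steering_cost_le[OF cont(1,2) zero this]
  \<comment> \<open>From here on \<open>C\<close> is the steering constant, no longer the growth
    constant.\<close>
  obtain C where C0: "\<And>x\<^sub>1 y\<^sub>1 \<theta>\<^sub>1. norm (x\<^sub>1, y\<^sub>1) \<ge> 24 \<Longrightarrow>
      \<exists>T u x y \<theta> \<kappa>. steers q start_state (x\<^sub>1, y\<^sub>1, \<theta>\<^sub>1, 0) T u x y \<theta> \<kappa> \<and>
        cost \<phi> \<psi> T u \<kappa> \<le> ennreal (norm (x\<^sub>1, y\<^sub>1) + C)"
    by blast
  fix \<eta> :: real assume "\<eta> > 0"
  \<comment> \<open>Constants are chosen backwards: \<open>polar_estimate\<close> doubles its error
    and \<open>adjoint_estimate\<close> multiplies it by 2000.\<close>
  define e\<^sub>0 where "e\<^sub>0 = min (\<eta> / 2) (1 / 2)"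
  define \<delta> where "\<delta> = min (1 / 12) (e\<^sub>0 / 2000)"
  have e0: "2 * e\<^sub>0 \<le> \<eta>" "e\<^sub>0 \<le> 1 / 2" and \<delta>: "0 < \<delta>" "\<delta> \<le> 1 / 12" "2000 * \<delta> \<le> e\<^sub>0"
    using \<open>\<eta> > 0\<close> by (auto simp: e\<^sub>0_def \<delta>_def)
  have "\<forall>\<^sub>F d in at_right 0. (\<forall>r. \<bar>r\<bar> \<le> d \<longrightarrow> \<bar>\<phi> r\<bar> \<le> \<delta>) \<and> (\<forall>r. \<bar>r\<bar> \<le> d \<longrightarrow> \<bar>\<psi> r\<bar> \<le> \<delta>) \<and>
      (\<forall>r. \<bar>r\<bar> \<le> d \<longrightarrow> \<bar>deriv \<phi> r\<bar> \<le> \<delta>) \<and> (\<forall>r. \<bar>r\<bar> \<le> d \<longrightarrow> \<bar>deriv \<psi> r\<bar> \<le> \<delta>) \<and> 0 < d \<and> d \<le> \<delta>"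
    using eventually_small_on_nbhd[OF cont(1) zero(1) \<delta>(1)] eventually_small_on_nbhd[OF cont(2) zero(2) \<delta>(1)]
      eventually_small_on_nbhd[OF cont(3) deriv0(1) \<delta>(1)] eventually_small_on_nbhd[OF cont(4) deriv0(2) \<delta>(1)]
      eventually_at_right_real[OF \<delta>(1)]
    by eventually_elim auto
  then obtain d where d: "0 < d" "d \<le> \<delta>"
    and small: "\<And>r. \<bar>r\<bar> \<le> d \<Longrightarrow> \<bar>\<phi> r\<bar> \<le> \<delta>" "\<And>r. \<bar>r\<bar> \<le> d \<Longrightarrow> \<bar>\<psi> r\<bar> \<le> \<delta>"
      "\<And>r. \<bar>r\<bar> \<le> d \<Longrightarrow> \<bar>deriv \<phi> r\<bar> \<le> \<delta>" "\<And>r. \<bar>r\<bar> \<le> d \<Longrightarrow> \<bar>deriv \<psi> r\<bar> \<le> \<delta>"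
    using eventually_happens'[OF trivial_limit_at_right_real] by blast
  \<comment> \<open>\<open>kinematic_estimate\<close> loses a factor of at most 11.\<close>
  define h where "h = d / 11"
  have h: "0 < h" "h \<le> 1" "11 * h = d" "h \<le> d" using d \<delta> by (auto simp: h_def)
  have \<psi>h: "\<psi> h > 0"
    using strictly_convex_even_pos[OF assms(11,4) zero(2)] h by simp
  define M where "M = h / \<psi> h"
  have M: "M > 0" using h \<psi>h by (simp add: M_def)
  have lin: "\<bar>r\<bar> \<le> h + M * \<psi> r" for r
    unfolding M_def by (rule strictly_convex_ge_linear[OF assms(11,4) zero(2) h(1)])
  have u_small: "\<bar>r\<bar> \<le> h" if "\<psi> r < \<psi> h" for r
  proof (rule ccontr)
    assume "\<not> \<bar>r\<bar> \<le> h"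
    then have "\<psi> h \<le> \<psi> \<bar>r\<bar>" using h by (intro mono_onD[OF assms(8)]) auto
    also have "\<psi> \<bar>r\<bar> = \<psi> r" using assms(4) by (simp add: even_fun_def abs_if)
    finally show False using that by simp
  qed
  \<comment> \<open>The first three bounds serve \<open>kinematic_estimate\<close>. Sample points
    satisfy \<open>E s \<le> 14 * \<epsilon>\<close>, and 15 instead of 14 makes this strictly
    smaller than \<open>\<psi> h\<close>, as \<open>u_small\<close> demands.\<close>
  define \<epsilon> where "\<epsilon> = min (min (1 / 7) (h\<^sup>2 / 28)) (min (h / M) (\<psi> h / 15))"
  have \<epsilon>: "0 < \<epsilon>" "M * \<epsilon> \<le> h" "28 * \<epsilon> \<le> h\<^sup>2" "\<epsilon> \<le> 1 / 7" "14 * \<epsilon> < \<psi> h"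
  proof -
    show "0 < \<epsilon>" using h M \<psi>h by (simp add: \<epsilon>_def)
    have "\<epsilon> \<le> h / M" "\<epsilon> \<le> h\<^sup>2 / 28" "\<epsilon> \<le> \<psi> h / 15" "\<epsilon> \<le> 1 / 7"
      unfolding \<epsilon>_def by linarith+
    then show "M * \<epsilon> \<le> h" "28 * \<epsilon> \<le> h\<^sup>2" "\<epsilon> \<le> 1 / 7" "14 * \<epsilon> < \<psi> h"
      using M \<psi>h by (simp_all add: pos_le_divide_eq mult.commute)
  qed
  obtain n\<^sub>0 :: nat where n0: "C / \<epsilon> \<le> real n\<^sub>0" using real_arch_simple by blast
  define n where "n = Suc n\<^sub>0"
  have n: "0 < n" "C \<le> real n * \<epsilon>"
    using n0 \<epsilon>(1) by (auto simp: n_def field_simps)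
  \<comment> \<open>24 makes steering possible, \<open>\<bar>C\<bar>\<close> keeps the cost bound
    nonnegative, and \<open>n\<close> makes room for \<open>n\<close> unit intervals.\<close>
  define R\<^sub>0 where "R\<^sub>0 = max (24 + \<bar>C\<bar>) (real n)"
  show "\<exists>R\<^sub>\<eta>>0. \<forall>x\<^sub>1 y\<^sub>1 \<theta>\<^sub>1 T u x y \<theta> \<kappa> p\<^sub>1 p\<^sub>2 p\<^sub>3 p\<^sub>4.
    optimal_trajectory \<phi> \<psi> q (x\<^sub>1, y\<^sub>1, \<theta>\<^sub>1, 0) T u x y \<theta> \<kappa> \<longrightarrow>
    norm (x\<^sub>1, y\<^sub>1) \<ge> R\<^sub>\<eta> \<longrightarrow>
    adjoint_vector \<phi> \<psi> T u \<theta> \<kappa> p\<^sub>1 p\<^sub>2 p\<^sub>3 p\<^sub>4 \<longrightarrow>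
    (\<forall>\<alpha>\<in>{0..<2 * pi}. \<forall>\<beta>\<in>{0..<2 * pi}. \<forall>\<rho>\<ge>0. \<forall>t\<in>{0..T}.
      (x\<^sub>1, y\<^sub>1) = norm (x\<^sub>1, y\<^sub>1) *\<^sub>R (cos \<alpha>, sin \<alpha>) \<longrightarrow>
      (p\<^sub>1 t, p\<^sub>2 t) = \<rho> *\<^sub>R (cos \<beta>, sin \<beta>) \<longrightarrow>
      \<bar>angle_diff \<beta> \<alpha>\<bar> \<le> \<eta> \<and> \<bar>\<rho> - 1\<bar> \<le> \<eta>)"
  proof (intro exI[of _ R\<^sub>0] conjI[of "0 < R\<^sub>0"] allI impI ballI)
    show "0 < R\<^sub>0" by (simp add: R\<^sub>0_def)
    fix x\<^sub>1 y\<^sub>1 \<theta>\<^sub>1 T u x y \<theta> \<kappa> p\<^sub>1 p\<^sub>2 p\<^sub>3 p\<^sub>4 \<alpha> \<beta> \<rho> t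
    assume opt: "optimal_trajectory \<phi> \<psi> q (x\<^sub>1, y\<^sub>1, \<theta>\<^sub>1, 0) T u x y \<theta> \<kappa>"
      and R0: "norm (x\<^sub>1, y\<^sub>1) \<ge> R\<^sub>0"
      and adj: "adjoint_vector \<phi> \<psi> T u \<theta> \<kappa> p\<^sub>1 p\<^sub>2 p\<^sub>3 p\<^sub>4"
      and "0 \<le> \<rho>" and tT: "t \<in> {0..T}"
      and \<alpha>: "(x\<^sub>1, y\<^sub>1) = norm (x\<^sub>1, y\<^sub>1) *\<^sub>R (cos \<alpha>, sin \<alpha>)"
      and \<beta>: "(p\<^sub>1 t, p\<^sub>2 t) = \<rho> *\<^sub>R (cos \<beta>, sin \<beta>)"
    have r: "24 \<le> norm (x\<^sub>1, y\<^sub>1)" "real n \<le> norm (x\<^sub>1, y\<^sub>1)" "0 \<le> norm (x\<^sub>1, y\<^sub>1) + C"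
      using R0 by (auto simp: R\<^sub>0_def)
    define E where "E t = 1 - cos (\<theta> t - \<alpha>) + \<phi> (\<kappa> t) + \<psi> (u t)" for t
    have E_ge: "1 - cos (\<theta> t - \<alpha>) \<le> E t" "\<psi> (u t) \<le> E t" "0 \<le> E t" for t
      using nonneg(1)[of "\<kappa> t"] nonneg(2)[of "u t"] cos_le_one[of "\<theta> t - \<alpha>"] unfolding E_def by linarith+
    note excess = optimal_trajectory_excess[OF opt \<alpha> nonneg cont(1,2) C0[OF r(1)] r(3)]
    have E: "E integrable_on {0..T}" "integral {0..T} E \<le> C"
      using excess(2,3) unfolding E_def[abs_def] by simp_all
    have "integral {0..T} E \<le> real n * \<epsilon>" using E(2) n(2) by (rule order_trans)
    moreover have T: "real n \<le> T" using excess(1) r(2) by linarith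
    ultimately obtain k where k: "k < n" "integral {real k..real k + 1} E \<le> \<epsilon>"
      using ex_unit_interval_small_integral[OF E(1) E_ge(3) n(1)] by blast
    define a where "a = real k"
    have a: "0 \<le> a" "a + 1 \<le> T" using k T by (auto simp: a_def)
    then have sub: "{a..a + 1} \<subseteq> {0..T}" by auto
    have Ea: "E integrable_on {a..a + 1}" "integral {a..a + 1} E \<le> \<epsilon>"
      using integrable_on_subinterval[OF E(1) sub] k(2) by (simp_all add: a_def)
    have sol: "solves_ae T \<theta> \<kappa>" "solves_ae T \<kappa> u"
      using opt by (auto simp: optimal_trajectory_def steers_def trajectory_def)
    have cont\<theta>: "continuous_on {0..T} \<theta>" and cont\<kappa>: "continuous_on {0..T} \<kappa>"
      using sol solves_ae_continuous_on by auto
    have p: "solves_ae T p\<^sub>1 (\<lambda>t. 0)" "solves_ae T p\<^sub>2 (\<lambda>t. 0)"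
        "solves_ae T p\<^sub>3 (\<lambda>t. p\<^sub>1 t * sin (\<theta> t) - p\<^sub>2 t * cos (\<theta> t))"
        "solves_ae T p\<^sub>4 (\<lambda>t. - p\<^sub>3 t + deriv \<phi> (\<kappa> t))"
      and ae: "AE t in lebesgue_on {0..T}. u t = inv (deriv \<psi>) (p\<^sub>4 t)"
        "AE t in lebesgue_on {0..T}. p\<^sub>1 t * cos (\<theta> t) + p\<^sub>2 t * sin (\<theta> t) + p\<^sub>3 t * \<kappa> t + p\<^sub>4 t * u t
          - (1 + \<phi> (\<kappa> t) + \<psi> (u t)) = 0"
      using adj by (auto simp: adjoint_vector_def)
    have const: "p\<^sub>1 s = \<rho> * cos \<beta>" "p\<^sub>2 s = \<rho> * sin \<beta>" if "s \<in> {0..T}" for s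
      using solves_ae_const[OF p(1) that] solves_ae_const[OF p(1) tT]
        solves_ae_const[OF p(2) that] solves_ae_const[OF p(2) tT] \<beta> by auto
    define A B where "A = \<rho> * cos (\<alpha> - \<beta>)" and "B = \<rho> * sin (\<alpha> - \<beta>)"
    have cs: "\<rho> * cos \<beta> = A * cos \<alpha> + B * sin \<alpha>" "\<rho> * sin \<beta> = A * sin \<alpha> - B * cos \<alpha>"
    proof -
      have "A * cos \<alpha> + B * sin \<alpha> = \<rho> * cos (\<alpha> - (\<alpha> - \<beta>))" "A * sin \<alpha> - B * cos \<alpha> = \<rho> * sin (\<alpha> - (\<alpha> - \<beta>))"
        unfolding cos_diff[of \<alpha> "\<alpha> - \<beta>"] sin_diff[of \<alpha> "\<alpha> - \<beta>"] A_def B_def by (simp_all add: algebra_simps)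
      then show "\<rho> * cos \<beta> = A * cos \<alpha> + B * sin \<alpha>" "\<rho> * sin \<beta> = A * sin \<alpha> - B * cos \<alpha>" by simp_all
    qed
    define w c where "w t = sin (\<theta> t - \<alpha>)" and "c t = cos (\<theta> t - \<alpha>)" for t
    have rot: "p\<^sub>1 s * sin (\<theta> s) - p\<^sub>2 s * cos (\<theta> s) = A * w s + B * c s"
      "p\<^sub>1 s * cos (\<theta> s) + p\<^sub>2 s * sin (\<theta> s) = A * c s - B * w s" if "s \<in> {0..T}" for s
      unfolding const[OF that] cs w_def c_def sin_diff cos_diff by (simp_all add: algebra_simps)
    have der_restrict: "(f has_real_derivative D) (at s within {a..a + 1})"
      if "(f has_real_derivative D) (at s within {0..T})" for f D s
      using that sub by (rule has_field_derivative_subset)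
    have contp: "continuous_on {0..T} p\<^sub>1" "continuous_on {0..T} p\<^sub>2" "continuous_on {0..T} p\<^sub>3"
      using p solves_ae_continuous_on by auto
    have d\<theta>: "(\<theta> has_real_derivative \<kappa> s) (at s within {a..a + 1})" if "s \<in> {a..a + 1}" for s
      using that sub by (intro der_restrict solves_ae_has_derivative[OF sol(1) cont\<kappa>]) auto
    have dp3: "(p\<^sub>3 has_real_derivative A * w s + B * c s) (at s within {a..a + 1})" if "s \<in> {a..a + 1}" for s
    proof -
      have "s \<in> {0..T}" using that sub by auto
      moreover have "continuous_on {0..T} (\<lambda>t. p\<^sub>1 t * sin (\<theta> t) - p\<^sub>2 t * cos (\<theta> t))"
        by (intro continuous_intros contp cont\<theta>)
      ultimately show ?thesis
        using der_restrict[OF solves_ae_has_derivative[OF p(3)]] rot(1) by force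
    qed
    have dp4: "(p\<^sub>4 has_real_derivative - p\<^sub>3 s + deriv \<phi> (\<kappa> s)) (at s within {a..a + 1})" if "s \<in> {a..a + 1}" for s
    proof -
      have "continuous_on {0..T} (\<lambda>t. - p\<^sub>3 t + deriv \<phi> (\<kappa> t))"
        by (intro continuous_intros contp continuous_on_compose2[OF cont(3) cont\<kappa>]) auto
      then show ?thesis
        using that sub by (intro der_restrict solves_ae_has_derivative[OF p(4)]) auto
    qed
    have kin: "\<bar>\<kappa> s\<bar> \<le> 10 * h" "\<bar>w s\<bar> \<le> 11 * h" "1 - 11 * h \<le> c s" if "s \<in> {a..a + 1}" for s
    proof -
      have u: "\<bar>u t\<bar> \<le> h + M * E t" for t
        using lin[of "u t"] mult_left_mono[OF E_ge(2)[of t], of M] M by linarith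
      have \<kappa>: "(u has_integral \<kappa> t - \<kappa> s) {s..t}" if "a \<le> s" "s \<le> t" "t \<le> a + 1" for s t
        using that a by (intro solves_ae_has_integral[OF sol(2)]) auto
      note K = kinematic_estimate[OF Ea E_ge(1) u \<epsilon>(1) h(1,2) less_imp_le[OF M] \<epsilon>(2,3,4) d\<theta> \<kappa> that]
      show "\<bar>\<kappa> s\<bar> \<le> 10 * h" "\<bar>w s\<bar> \<le> 11 * h" "1 - 11 * h \<le> c s"
        unfolding w_def c_def by (rule K; assumption)+
    qed
    have "{0..T} \<in> sets lebesgue" by simp
    note AE_iff = AE_lebesgue_on_iff_negligible[OF this]
    obtain N\<^sub>1 where N1: "negligible N\<^sub>1" "\<And>s. s \<in> {0..T} - N\<^sub>1 \<Longrightarrow> u s = inv (deriv \<psi>) (p\<^sub>4 s)"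
      using ae(1) unfolding AE_iff by blast
    obtain N\<^sub>2 where N2: "negligible N\<^sub>2" "\<And>s. s \<in> {0..T} - N\<^sub>2 \<Longrightarrow>
        p\<^sub>1 s * cos (\<theta> s) + p\<^sub>2 s * sin (\<theta> s) + p\<^sub>3 s * \<kappa> s + p\<^sub>4 s * u s - (1 + \<phi> (\<kappa> s) + \<psi> (u s)) = 0"
      using ae(2) unfolding AE_iff by blast
    \<comment> \<open>The sample point avoids both null sets, so the formula for the control and the
      Hamiltonian identity hold there, and smallness of \<open>u\<close> passes to
      \<open>p\<^sub>4\<close>.\<close>
    have good: "\<exists>s\<in>{b..b + 1 / 7}. \<bar>p\<^sub>4 s\<bar> \<le> \<delta> \<and> \<bar>u s\<bar> \<le> h \<and>
        A * c s - B * w s + p\<^sub>3 s * \<kappa> s + p\<^sub>4 s * u s - (1 + \<phi> (\<kappa> s) + \<psi> (u s)) = 0"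
      if b: "a \<le> b" "b + 1 / 7 \<le> a + 1" for b
    proof -
      obtain s where s: "s \<in> {b..b + 1 / 7}" "s \<notin> N\<^sub>1 \<union> N\<^sub>2" "E s * (b + 1 / 7 - b) \<le> 2 * \<epsilon>"
        using ex_small_point[OF Ea E_ge(3) \<epsilon>(1) b(1) _ b(2) negligible_Un[OF N1(1) N2(1)]] by auto
      have sT: "s \<in> {0..T}" using s(1) b a by auto
      have "\<psi> (u s) < \<psi> h" using E_ge(2)[of s] s(3) \<epsilon>(5) by simp
      then have us: "\<bar>u s\<bar> \<le> h" by (rule u_small)
      have "p\<^sub>4 s = deriv \<psi> (u s)" using N1(2)[of s] s(2) sT surj_f_inv_f[OF surj] by auto
      then have "\<bar>p\<^sub>4 s\<bar> \<le> \<delta>" using small(4)[of "u s"] us h by simp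
      then show ?thesis using s(1) us N2(2)[of s] s(2) sT rot(2)[OF sT] by (intro bexI[of _ s]) auto
    qed
    \<comment> \<open>Windows start at even multiples of 1/7, so consecutive sample times are at
      least 1/7 apart.\<close>
    obtain t\<^sub>1 where t1: "t\<^sub>1 \<in> {a..a + 1 / 7}" "\<bar>p\<^sub>4 t\<^sub>1\<bar> \<le> \<delta>" "\<bar>u t\<^sub>1\<bar> \<le> h"
      and H: "A * c t\<^sub>1 - B * w t\<^sub>1 + p\<^sub>3 t\<^sub>1 * \<kappa> t\<^sub>1 + p\<^sub>4 t\<^sub>1 * u t\<^sub>1 - (1 + \<phi> (\<kappa> t\<^sub>1) + \<psi> (u t\<^sub>1)) = 0"
      using good[of a] by auto
    obtain t\<^sub>2 where t2: "t\<^sub>2 \<in> {a + 2 / 7..a + 2 / 7 + 1 / 7}" "\<bar>p\<^sub>4 t\<^sub>2\<bar> \<le> \<delta>"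
      using good[of "a + 2 / 7"] by auto
    obtain t\<^sub>3 where t3: "t\<^sub>3 \<in> {a + 4 / 7..a + 4 / 7 + 1 / 7}" "\<bar>p\<^sub>4 t\<^sub>3\<bar> \<le> \<delta>"
      using good[of "a + 4 / 7"] by auto
    obtain t\<^sub>4 where t4: "t\<^sub>4 \<in> {a + 6 / 7..a + 6 / 7 + 1 / 7}" "\<bar>p\<^sub>4 t\<^sub>4\<bar> \<le> \<delta>"
      using good[of "a + 6 / 7"] by auto
    have \<kappa>d: "\<bar>\<kappa> s\<bar> \<le> d" if "s \<in> {a..a + 1}" for s using kin(1)[OF that] h by linarith
    have t1I: "t\<^sub>1 \<in> {a..a + 1}" using t1 by auto
    have ts: "a \<le> t\<^sub>1" "t\<^sub>1 + 1 / 7 \<le> t\<^sub>2" "t\<^sub>2 + 1 / 7 \<le> t\<^sub>3" "t\<^sub>3 + 1 / 7 \<le> t\<^sub>4" "t\<^sub>4 \<le> a + 1"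
      using t1(1) t2(1) t3(1) t4(1) by auto
    have w\<delta>: "\<bar>w s\<bar> \<le> \<delta>" and c\<delta>: "1 - \<delta> \<le> c s" "c s \<le> 1" and \<phi>\<delta>: "\<bar>deriv \<phi> (\<kappa> s)\<bar> \<le> \<delta>"
      if "s \<in> {a..a + 1}" for s
      using kin(2,3)[OF that] h d small(3)[OF \<kappa>d[OF that]] by (simp_all add: c_def)
    have small1: "\<bar>\<kappa> t\<^sub>1\<bar> \<le> \<delta>" "\<bar>u t\<^sub>1\<bar> \<le> \<delta>" "\<bar>\<phi> (\<kappa> t\<^sub>1)\<bar> \<le> \<delta>" "\<bar>\<psi> (u t\<^sub>1)\<bar> \<le> \<delta>"
      using \<kappa>d[OF t1I] t1(3) h d small(1)[OF \<kappa>d[OF t1I]] small(2)[of "u t\<^sub>1"] by simp_all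
    have "\<bar>A - 1\<bar> \<le> 2000 * \<delta>" "\<bar>B\<bar> \<le> 2000 * \<delta>"
      using adjoint_estimate[OF \<delta>(1,2) ts order_refl dp3 dp4 w\<delta> c\<delta> \<phi>\<delta> t1(2) t2(2) t3(2) t4(2) small1 H]
      by simp_all
    then have "\<bar>\<rho> * cos (\<alpha> - \<beta>) - 1\<bar> \<le> e\<^sub>0" "\<bar>\<rho> * sin (\<alpha> - \<beta>)\<bar> \<le> e\<^sub>0"
      using \<delta>(3) unfolding A_def B_def by linarith+
    from polar_estimate[OF e0(2) \<open>0 \<le> \<rho>\<close> this]
    show "\<bar>angle_diff \<beta> \<alpha>\<bar> \<le> \<eta> \<and> \<bar>\<rho> - 1\<bar> \<le> \<eta>" using e0(1) by linarith
  qed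
qed

end
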